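(* Let $(\mathcal{A},\nu)$ and $(\mathcal{B},\nu)$ be effective topologies (with the same coding $\nu$) having recursively enumerable subset relations, such that $\mathcal{B}\subseteq\mathcal{A}$ and $\mathcal{A}$ and $\mathcal{B}$ are bases for the same topology. If $\phi$ is an oracle for $x$ in $(\mathcal{A},\nu)$, then there exists an oracle $\psi$ for $x$ in $(\mathcal{B},\nu)$ that is recursive relative to $\phi$ uniformly.
   Context: A coding of a countable basis $\mathcal{B}$ is a (not necessarily injective) assignment $n\mapsto\nu(n)$ of sets to non-negative integers such that every member of $\mathcal{B}$ is coded; $\mathrm{dom}_{\mathcal{B}}\nu$ denotes the set of non-negative integers $n$ with $\nu(n)\in\mathcal{B}$. $(\mathcal{B},\nu)$ is an effective topology iff $\mathcal{B}$ is a countable basis for a $T_0$ topology and $\nu$ is a coding of $\mathcal{B}$. A set $\mathcal{L}_x\subseteq\mathcal{B}$ is a local basis for $x$ iff every member contains $x$ and every $B\in\mathcal{B}$ containing $x$ has a subset in $\mathcal{L}_x$. With $\mathbb{N}$ the non-negative integers, $\phi:\mathbb{N}\to\mathrm{dom}_{\mathcal{B}}\nu$ is an oracle for $x$ in $(\mathcal{B},\nu)$ iff $\{\nu(\phi(n)):n\in\mathbb{N}\}$ is a local basis for $x$. The subset relation of $(\mathcal{B},\nu)$ is recursively enumerable iff $\{\langle b_1,b_2\rangle: b_1,b_2\in\mathrm{dom}_{\mathcal{B}}\nu,\ \nu(b_1)\subseteq\nu(b_2)\}$ is recursively enumerable (Cantor pairing). "Recursive relative to $\phi$ uniformly" means computed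 from $\phi$ by an oracle Turing machine not depending on $\phi$. *)

theory Defs
  imports "HOL-Analysis.Analysis" "HOL-Library.Nat_Bijection"
begin

subsection \<open>Oracle Turing machines\<close>

text \<open>
  Tapes are two-way infinite. The head is always at cell 0: moving the head shifts the tape.
  Symbols are natural numbers; 0 is the blank and 1 is the stroke.
\<close>

type_synonym tape = "int \<Rightarrow> nat"

datatype direction = MoveLeft | Stay | MoveRight

fun move_head :: "direction \<Rightarrow> tape \<Rightarrow> tape" where
  "move_head MoveLeft t = (\<lambda>i. t (i - 1))"
| "move_head Stay t = t"
| "move_head MoveRight t = (\<lambda>i. t (i + 1))"

definition act :: "nat \<times> direction \<Rightarrow> tape \<Rightarrow> tape" where
  "act a t = move_head (snd a) (t(0 := fst a))"

text \<open>Numbers are written in unary, from the head to the right.\<close>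

definition blank_tape :: tape where
  "blank_tape = (\<lambda>_. 0)"

definition num_tape :: "nat \<Rightarrow> tape" where
  "num_tape n = (\<lambda>i. if 0 \<le> i \<and> i < int n then 1 else 0)"

text \<open>
  The minimum exists for every tape that a machine can reach, since only finitely many cells
  of such a tape are non-blank.
\<close>

definition read_num :: "tape \<Rightarrow> nat" where
  "read_num t = (LEAST n. t (int n) \<noteq> 1)"

record otm =
  n_states :: nat
  n_symbols :: nat
  n_tapes :: nat
  start_state :: nat
  halt_state :: nat
  query_state :: nat
  answer_state :: nat
  delta :: "nat \<Rightarrow> nat list \<Rightarrow> nat \<times> (nat \<times> direction) list"

text \<open>
  Tape 0 is the input and output tape and tape 1 is the oracle tape. The bounds make the
  relevant part of \<open>delta\<close> a finite table.
\<close>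

definition oracle_machine :: "otm \<Rightarrow> bool" where
  "oracle_machine M \<longleftrightarrow>
     2 \<le> n_tapes M \<and> 2 \<le> n_symbols M \<and>
     start_state M < n_states M \<and> halt_state M < n_states M \<and>
     query_state M < n_states M \<and> answer_state M < n_states M \<and>
     halt_state M \<noteq> query_state M \<and>
     (\<forall>q ss. q < n_states M \<and> length ss = n_tapes M \<and> (\<forall>s\<in>set ss. s < n_symbols M) \<longrightarrow>
        fst (delta M q ss) < n_states M \<and>
        length (snd (delta M q ss)) = n_tapes M \<and>
        (\<forall>a\<in>set (snd (delta M q ss)). fst a < n_symbols M))"

type_synonym config = "nat \<times> tape list"

text \<open>In the query state, the number \<open>n\<close> on the oracle tape is replaced by \<open>\<phi> n\<close> in one step.\<close>

definition step :: "otm \<Rightarrow> (nat \<Rightarrow> nat) \<Rightarrow> config \<Rightarrow> config" where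
  "step M \<phi> c = (case c of (q, ts) \<Rightarrow>
     if q = halt_state M then c
     else if q = query_state M then
       (answer_state M, ts[1 := num_tape (\<phi> (read_num (ts ! 1)))])
     else
       (case delta M q (map (\<lambda>t. t 0) ts) of (q', as) \<Rightarrow> (q', map2 act as ts)))"

definition init_config :: "otm \<Rightarrow> nat \<Rightarrow> config" where
  "init_config M n = (start_state M, num_tape n # replicate (n_tapes M - 1) blank_tape)"

definition computes :: "otm \<Rightarrow> (nat \<Rightarrow> nat) \<Rightarrow> (nat \<Rightarrow> nat) \<Rightarrow> bool" where
  "computes M \<phi> f \<longleftrightarrow>
     (\<forall>n. \<exists>k q ts. (step M \<phi> ^^ k) (init_config M n) = (q, ts) \<and>
        q = halt_state M \<and> read_num (ts ! 0) = f n)"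

text \<open>An ordinary Turing machine is one that never enters the query state.\<close>

definition oracle_free :: "otm \<Rightarrow> bool" where
  "oracle_free M \<longleftrightarrow>
     start_state M \<noteq> query_state M \<and>
     (\<forall>q ss. q < n_states M \<and> length ss = n_tapes M \<and> (\<forall>s\<in>set ss. s < n_symbols M) \<longrightarrow>
        fst (delta M q ss) \<noteq> query_state M)"

text \<open>The oracle below is a dummy, since an oracle-free machine never consults it.\<close>

definition recursive_fun :: "(nat \<Rightarrow> nat) \<Rightarrow> bool" where
  "recursive_fun f \<longleftrightarrow> (\<exists>M. oracle_machine M \<and> oracle_free M \<and> computes M (\<lambda>_. 0) f)"

definition rec_enumerable :: "nat set \<Rightarrow> bool" where
  "rec_enumerable S \<longleftrightarrow> S = {} \<or> (\<exists>f. recursive_fun f \<and> S = range f)"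


subsection \<open>Effective topologies\<close>

definition basis_for :: "'a set set \<Rightarrow> 'a topology \<Rightarrow> bool" where
  "basis_for \<B> X \<longleftrightarrow> openin X = arbitrary union_of (\<lambda>U. U \<in> \<B>)"

text \<open>
  A coding is a total map \<open>\<nu>\<close>, which may take values outside \<open>\<B>\<close>.
\<close>

definition coding :: "'a set set \<Rightarrow> (nat \<Rightarrow> 'a set) \<Rightarrow> bool" where
  "coding \<B> \<nu> \<longleftrightarrow> \<B> \<subseteq> range \<nu>"

definition code_dom :: "'a set set \<Rightarrow> (nat \<Rightarrow> 'a set) \<Rightarrow> nat set" where
  "code_dom \<B> \<nu> = {n. \<nu> n \<in> \<B>}"

definition effective_topology :: "'a set set \<Rightarrow> (nat \<Rightarrow> 'a set) \<Rightarrow> bool" where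
  "effective_topology \<B> \<nu> \<longleftrightarrow>
     countable \<B> \<and> (\<exists>X. t0_space X \<and> basis_for \<B> X) \<and> coding \<B> \<nu>"

definition local_basis :: "'a set set \<Rightarrow> 'a \<Rightarrow> 'a set set \<Rightarrow> bool" where
  "local_basis \<B> x \<L> \<longleftrightarrow>
     \<L> \<subseteq> \<B> \<and> (\<forall>L\<in>\<L>. x \<in> L) \<and> (\<forall>B\<in>\<B>. x \<in> B \<longrightarrow> (\<exists>L\<in>\<L>. L \<subseteq> B))"

definition oracle_for ::
  "'a set set \<Rightarrow> (nat \<Rightarrow> 'a set) \<Rightarrow> 'a \<Rightarrow> (nat \<Rightarrow> nat) \<Rightarrow> bool" where
  "oracle_for \<B> \<nu> x \<phi> \<longleftrightarrow>
     (\<forall>n. \<phi> n \<in> code_dom \<B> \<nu>) \<and> local_basis \<B> x {\<nu> (\<phi> n) | n. True}"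

definition re_subset_relation :: "'a set set \<Rightarrow> (nat \<Rightarrow> 'a set) \<Rightarrow> bool" where
  "re_subset_relation \<B> \<nu> \<longleftrightarrow>
     rec_enumerable {prod_encode (b1, b2) | b1 b2.
       b1 \<in> code_dom \<B> \<nu> \<and> b2 \<in> code_dom \<B> \<nu> \<and> \<nu> b1 \<subseteq> \<nu> b2}"

end

(*
  If phi is an oracle for x in A, then the codes b of members of B such that nu (phi n) is a subset
  of nu b for some n are exactly the codes of the members of B that contain x, since phi runs through
  a local basis in A and B is contained in A. Both conditions on b are recursively enumerable
  (b codes a member of B iff (b, b) lies in the subset relation of B), so psi is obtained by searching
  through all candidates. Some candidate is always found because A and B generate the same topology.
  If B has no code at all, then no oracle phi exists.

  The search is written as a structured program on tapes and compiled to an oracle machine; the two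
  given enumerating machines are run as subroutines, whose tapes are erased after each call.
*)

theory Submission
  imports Defs
begin

section \<open>Structured programs on tapes\<close>

text \<open>The input \<open>m\<close> of \<psi> is the point where the search starts:
  \<open>\<psi> m\<close> is read off the first accepted candidate from \<open>m\<close> on, so no
  record of earlier finds is kept. A padding component in each candidate makes acceptance recur
  beyond every \<open>m\<close>, hence \<psi> is total; and a search started at an accepted
  candidate returns that candidate, hence \<psi> reaches every member of \<B> that contains
  \<open>x\<close>. The machine model is the real obstacle. With a single answer state a query has
  only one return address, so the program contains exactly one query, placed in the body of its
  loop. A subroutine leaves unknown symbols on its tapes, and no scan can tell where they end. But
  \<open>j\<close> steps on input \<open>n\<close> leave every cell farther than
  \<open>n + j\<close> from the head blank, so counting the steps yields a region that is safe to
  erase.\<close>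

type_synonym store = "nat \<Rightarrow> tape"
type_synonym heads = "nat \<Rightarrow> nat"
type_synonym actions = "nat \<Rightarrow> nat \<times> direction"

datatype com =
    Act "heads \<Rightarrow> actions"
  | Query
  | Seq com com  (infixr \<open>;;\<close> 60)
  | Cond "heads \<Rightarrow> bool" com com
  | While "heads \<Rightarrow> bool" com

definition heads :: "store \<Rightarrow> heads" where
  "heads \<sigma> = (\<lambda>i. \<sigma> i 0)"

definition idle :: "heads \<Rightarrow> actions" where
  "idle r = (\<lambda>i. (r i, Stay))"

inductive exec :: "(nat \<Rightarrow> nat) \<Rightarrow> com \<Rightarrow> store \<Rightarrow> store \<Rightarrow> bool" for \<phi> where
  exec_Act: "exec \<phi> (Act f) \<sigma> (\<lambda>i. act (f (heads \<sigma>) i) (\<sigma> i))"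
| exec_Query: "exec \<phi> Query \<sigma> (\<sigma>(1 := num_tape (\<phi> (read_num (\<sigma> 1)))))"
| exec_Seq: "exec \<phi> c \<sigma> \<sigma>' \<Longrightarrow> exec \<phi> d \<sigma>' \<sigma>'' \<Longrightarrow> exec \<phi> (c ;; d) \<sigma> \<sigma>''"
| exec_CondT: "b (heads \<sigma>) \<Longrightarrow> exec \<phi> c \<sigma> \<sigma>' \<Longrightarrow> exec \<phi> (Cond b c d) \<sigma> \<sigma>'"
| exec_CondF: "\<not> b (heads \<sigma>) \<Longrightarrow> exec \<phi> d \<sigma> \<sigma>' \<Longrightarrow> exec \<phi> (Cond b c d) \<sigma> \<sigma>'"
| exec_WhileF: "\<not> b (heads \<sigma>) \<Longrightarrow> exec \<phi> (While b c) \<sigma> \<sigma>"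
| exec_WhileT: "b (heads \<sigma>) \<Longrightarrow> exec \<phi> c \<sigma> \<sigma>' \<Longrightarrow> exec \<phi> (While b c) \<sigma>' \<sigma>'' \<Longrightarrow>
    exec \<phi> (While b c) \<sigma> \<sigma>''"

text \<open>A store has infinitely many tapes, whereas a machine sees \<open>N\<close> of them and
  writes symbols below \<open>S\<close>. Locality and boundedness are what allows tests and actions
  to become entries of a finite transition table.\<close>

definition local_test :: "nat \<Rightarrow> (heads \<Rightarrow> bool) \<Rightarrow> bool" where
  "local_test N b \<longleftrightarrow> (\<forall>r r'. (\<forall>i<N. r i = r' i) \<longrightarrow> b r = b r')"

definition local_act :: "nat \<Rightarrow> (heads \<Rightarrow> actions) \<Rightarrow> bool" where
  "local_act N f \<longleftrightarrow> (\<forall>r r'. (\<forall>i<N. r i = r' i) \<longrightarrow> (\<forall>i<N. f r i = f r' i))"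

definition bounded_act :: "nat \<Rightarrow> nat \<Rightarrow> (heads \<Rightarrow> actions) \<Rightarrow> bool" where
  "bounded_act N S f \<longleftrightarrow> (\<forall>r. (\<forall>i<N. r i < S) \<longrightarrow> (\<forall>i<N. fst (f r i) < S))"

fun wf_com :: "nat \<Rightarrow> nat \<Rightarrow> com \<Rightarrow> bool" where
  "wf_com N S (Act f) \<longleftrightarrow> local_act N f \<and> bounded_act N S f"
| "wf_com N S Query \<longleftrightarrow> True"
| "wf_com N S (c ;; d) \<longleftrightarrow> wf_com N S c \<and> wf_com N S d"
| "wf_com N S (Cond b c d) \<longleftrightarrow> local_test N b \<and> wf_com N S c \<and> wf_com N S d"
| "wf_com N S (While b c) \<longleftrightarrow> local_test N b \<and> wf_com N S c"

fun num_queries :: "com \<Rightarrow> nat" where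
  "num_queries (Act f) = 0"
| "num_queries Query = 1"
| "num_queries (c ;; d) = num_queries c + num_queries d"
| "num_queries (Cond b c d) = num_queries c + num_queries d"
| "num_queries (While b c) = num_queries c"


section \<open>Compilation to oracle machines\<close>

fun len :: "com \<Rightarrow> nat" where
  "len (Act f) = 1"
| "len Query = 1"
| "len (c ;; d) = len c + len d"
| "len (Cond b c d) = len c + len d + 2"
| "len (While b c) = len c + 2"

text \<open>
  The code of a program placed at address \<open>p\<close>, with absolute jumps. The entry \<open>None\<close> marks a
  query. A machine has only one query state, so a program must contain exactly one query.
\<close>

fun emit :: "com \<Rightarrow> nat \<Rightarrow> (heads \<Rightarrow> nat \<times> actions) option list" where
  "emit (Act f) p = [Some (\<lambda>r. (p + 1, f r))]"
| "emit Query p = [None]"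
| "emit (c ;; d) p = emit c p @ emit d (p + len c)"
| "emit (Cond b c d) p =
     Some (\<lambda>r. (if b r then p + 1 else p + len c + 2, idle r)) # emit c (p + 1) @
     Some (\<lambda>r. (p + len c + len d + 2, idle r)) # emit d (p + len c + 2)"
| "emit (While b c) p =
     Some (\<lambda>r. (if b r then p + 1 else p + len c + 2, idle r)) # emit c (p + 1) @
     [Some (\<lambda>r. (p, idle r))]"

definition head_syms :: "nat list \<Rightarrow> heads" where
  "head_syms ss = (\<lambda>i. if i < length ss then ss ! i else 0)"

text \<open>A query falls through to the next address, and a program halts by running off its end.
  The default for \<open>None\<close> is met only in the query and halting states, which
  \<open>step\<close> treats before it consults \<open>delta\<close>; it keeps the table within its
  bounds.\<close>

definition machine :: "nat \<Rightarrow> nat \<Rightarrow> com \<Rightarrow> nat \<Rightarrow> otm" where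
  "machine N S c a = \<lparr> n_states = len c + 1, n_symbols = S, n_tapes = N,
     start_state = 0, halt_state = len c, query_state = a, answer_state = a + 1,
     delta = (\<lambda>q ss. case (if q < len c then emit c 0 ! q else None) of
         None \<Rightarrow> (0, replicate N (0, Stay))
       | Some f \<Rightarrow> (fst (f (head_syms ss)), map (snd (f (head_syms ss))) [0..<N])) \<rparr>"

section \<open>Shape and bounds of the emitted code\<close>

lemma length_code [simp]: "length (emit c p) = len c"
  by (induction c arbitrary: p) auto

lemma num_queries_code: "length (filter (\<lambda>x. x = None) (emit c p)) = num_queries c"
  by (induction c arbitrary: p) auto

lemma unique_query_address:
  assumes "num_queries c = 1"
  obtains a where "a < len c" "\<And>i. i < len c \<Longrightarrow> emit c 0 ! i = None \<longleftrightarrow> i = a"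
proof -
  have "card {i. i < len c \<and> emit c 0 ! i = None} = 1"
    using assms num_queries_code[of c 0] by (simp add: length_filter_conv_card)
  then obtain a where "{i. i < len c \<and> emit c 0 ! i = None} = {a}"
    by (auto simp: card_1_singleton_iff)
  then show ?thesis by (intro that[of a]) auto
qed

lemma act_idle [simp]: "act (t 0, Stay) t = t"
  by (simp add: act_def)

lemma local_act_idle [simp]: "local_act N idle"
  by (simp add: local_act_def idle_def)

lemma bounded_act_idle [simp]: "bounded_act N S idle"
  by (simp add: bounded_act_def idle_def)

text \<open>As \<open>q\<close> is arbitrary, the second claim says that the next address depends on
  the first \<open>N\<close> heads only. The first claim allows the value \<open>p + len c\<close>,
  since a jump may leave the block at its end.\<close>

lemma code_props:
  assumes "wf_com N S c" "Some f \<in> set (emit c p)"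
  shows "fst (f r) \<le> p + len c" "local_test N (\<lambda>r. fst (f r) = q)"
    "local_act N (\<lambda>r. snd (f r))" "bounded_act N S (\<lambda>r. snd (f r))"
proof -
  have "fst (f r) \<le> p + len c \<and> local_test N (\<lambda>r. fst (f r) = q) \<and>
    local_act N (\<lambda>r. snd (f r)) \<and> bounded_act N S (\<lambda>r. snd (f r))"
    using assms
  proof (induction c arbitrary: p)
    case (Seq c d)
    then show ?case by fastforce
  next
    case (Cond b c d)
    then have "local_test N b" by simp
    then have b: "b r = b r'" if "\<forall>i<N. r i = r' i" for r r'
      using that unfolding local_test_def by blast
    from Cond.prems(2) consider
        "f = (\<lambda>r. (if b r then p + 1 else p + len c + 2, idle r))"
      | "Some f \<in> set (emit c (p + 1))"
      | "f = (\<lambda>r. (p + len c + len d + 2, idle r))"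
      | "Some f \<in> set (emit d (p + len c + 2))"
      by auto
    then show ?case
    proof cases
      case 1
      have "local_test N (\<lambda>r. fst (f r) = q)"
        unfolding local_test_def 1 by (auto dest: b)
      then show ?thesis by (simp add: 1)
    next
      case 2
      from Cond.IH(1)[OF _ this] Cond.prems(1) show ?thesis by auto
    next
      case 3
      then show ?thesis by (simp add: local_test_def)
    next
      case 4
      from Cond.IH(2)[OF _ this] Cond.prems(1) show ?thesis by auto
    qed
  next
    case (While b c)
    then have "local_test N b" by simp
    then have b: "b r = b r'" if "\<forall>i<N. r i = r' i" for r r'
      using that unfolding local_test_def by blast
    from While.prems(2) consider
        "f = (\<lambda>r. (if b r then p + 1 else p + len c + 2, idle r))"
      | "Some f \<in> set (emit c (p + 1))"
      | "f = (\<lambda>r. (p, idle r))"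
      by auto
    then show ?case
    proof cases
      case 1
      have "local_test N (\<lambda>r. fst (f r) = q)"
        unfolding local_test_def 1 by (auto dest: b)
      then show ?thesis by (simp add: 1)
    next
      case 2
      from While.IH[OF _ this] While.prems(1) show ?thesis by auto
    next
      case 3
      then show ?thesis by (simp add: local_test_def)
    qed
  qed (auto simp: local_test_def)
  then show "fst (f r) \<le> p + len c" "local_test N (\<lambda>r. fst (f r) = q)"
    "local_act N (\<lambda>r. snd (f r))" "bounded_act N S (\<lambda>r. snd (f r))" by auto
qed

lemma oracle_machine_machine:
  assumes "wf_com N S c" "2 \<le> N" "2 \<le> S" "a < len c"
  shows "oracle_machine (machine N S c a)"
proof -
  have "fst (f r) < len c + 1" if "q < len c" "emit c 0 ! q = Some f" for q f r
    using code_props(1)[OF assms(1), of f 0 r] that nth_mem[of q "emit c 0"] by simp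
  moreover have "fst (snd (f (head_syms ss)) i) < S"
    if "q < len c" "emit c 0 ! q = Some f" "length ss = N" "\<forall>s\<in>set ss. s < S" "i < N"
    for q f ss i
    using code_props(4)[OF assms(1), of f 0] that nth_mem[of q "emit c 0"]
    by (simp add: bounded_act_def head_syms_def)
  ultimately show ?thesis
    using assms by (auto simp: oracle_machine_def machine_def split: option.splits if_splits)
qed

section \<open>Correctness of the compilation\<close>

definition reaches :: "otm \<Rightarrow> (nat \<Rightarrow> nat) \<Rightarrow> config \<Rightarrow> config \<Rightarrow> bool" where
  "reaches M \<phi> c d \<longleftrightarrow> (\<exists>k. (step M \<phi> ^^ k) c = d)"

lemma reaches_refl: "reaches M \<phi> c c"
  unfolding reaches_def by (rule exI[of _ 0]) simp

lemma reaches_step: "step M \<phi> c = d \<Longrightarrow> reaches M \<phi> c d"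
  unfolding reaches_def by (rule exI[of _ 1]) simp

lemma reaches_trans [trans]:
  assumes "reaches M \<phi> c d" "reaches M \<phi> d e"
  shows "reaches M \<phi> c e"
proof -
  from assms obtain k l where "(step M \<phi> ^^ k) c = d" "(step M \<phi> ^^ l) d = e"
    by (auto simp: reaches_def)
  then have "(step M \<phi> ^^ (l + k)) c = e" by (simp add: funpow_add)
  then show ?thesis by (auto simp: reaches_def)
qed

context
  fixes N S :: nat and c0 :: com and a :: nat
  assumes wf0: "wf_com N S c0"
    and N2: "2 \<le> N"
    and query: "\<And>i. i < len c0 \<Longrightarrow> emit c0 0 ! i = None \<longleftrightarrow> i = a"
begin

lemma step_machine:
  assumes "p < len c0" "emit c0 0 ! p = Some f"
  shows "step (machine N S c0 a) \<phi> (p, map \<sigma> [0..<N]) =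
    (fst (f (heads \<sigma>)), map (\<lambda>i. act (snd (f (heads \<sigma>)) i) (\<sigma> i)) [0..<N])"
proof -
  let ?r = "head_syms (map (\<lambda>t. t 0) (map \<sigma> [0..<N]))"
  have mem: "Some f \<in> set (emit c0 0)"
    using assms nth_mem[of p "emit c0 0"] by simp
  have eq: "\<forall>i<N. ?r i = heads \<sigma> i" by (simp add: head_syms_def heads_def)
  have 1: "fst (f ?r) = fst (f (heads \<sigma>))"
    using code_props(2)[OF wf0 mem, of "fst (f ?r)"] eq unfolding local_test_def by metis
  have 2: "\<forall>i<N. snd (f ?r) i = snd (f (heads \<sigma>)) i"
    using code_props(3)[OF wf0 mem] eq unfolding local_act_def by metis
  have "p \<noteq> a" using query assms by force
  with assms 1 2 show ?thesis
    by (auto simp: step_def machine_def intro!: nth_equalityI)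
qed

lemma step_query:
  assumes "p < len c0" "emit c0 0 ! p = None"
  shows "step (machine N S c0 a) \<phi> (p, map \<sigma> [0..<N]) =
    (p + 1, map (\<sigma>(1 := num_tape (\<phi> (read_num (\<sigma> 1))))) [0..<N])"
proof -
  have "p = a" using query assms by blast
  with assms N2 show ?thesis
    by (auto simp: step_def machine_def nth_list_update intro!: nth_equalityI)
qed

text \<open>Jumps are absolute, so the code of a subprogram makes sense only at its own place in the
  whole program \<open>c0\<close>; the claim is therefore about a segment of \<open>c0\<close>
  starting at \<open>p\<close>. The induction follows the execution, which unrolls loops.\<close>

lemma code_correct:
  assumes "exec \<phi> c \<sigma> \<sigma>'" "p + len c \<le> len c0"
    and "\<And>i. i < len c \<Longrightarrow> emit c0 0 ! (p + i) = emit c p ! i"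
  shows "reaches (machine N S c0 a) \<phi> (p, map \<sigma> [0..<N]) (p + len c, map \<sigma>' [0..<N])"
  using assms
proof (induction arbitrary: p rule: exec.induct)
  case (exec_Act f \<sigma>)
  have "emit c0 0 ! p = Some (\<lambda>r. (p + 1, f r))" "p < len c0"
    using exec_Act(2)[of 0] exec_Act(1) by auto
  from step_machine[OF this(2,1)] show ?case by (intro reaches_step) simp
next
  case (exec_Query \<sigma>)
  have "emit c0 0 ! p = None" "p < len c0"
    using exec_Query(2)[of 0] exec_Query(1) by auto
  from step_query[OF this(2,1)] show ?case by (intro reaches_step) simp
next
  case (exec_Seq c \<sigma> \<sigma>' d \<sigma>'')
  have "reaches (machine N S c0 a) \<phi> (p, map \<sigma> [0..<N]) (p + len c, map \<sigma>' [0..<N])"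
  proof (rule exec_Seq.IH(1))
    show "p + len c \<le> len c0" using exec_Seq.prems by simp
    show "emit c0 0 ! (p + i) = emit c p ! i" if "i < len c" for i
      using exec_Seq.prems(2)[of i] that by (simp add: nth_append)
  qed
  also have "reaches (machine N S c0 a) \<phi> (p + len c, map \<sigma>' [0..<N])
      (p + len c + len d, map \<sigma>'' [0..<N])"
  proof (rule exec_Seq.IH(2))
    show "p + len c + len d \<le> len c0" using exec_Seq.prems by simp
    show "emit c0 0 ! (p + len c + i) = emit d (p + len c) ! i" if "i < len d" for i
      using exec_Seq.prems(2)[of "len c + i"] that by (simp add: nth_append add.assoc)
  qed
  finally show ?case by (simp add: add.assoc)
next
  case (exec_CondT b \<sigma> c \<sigma>' d)
  have *: "emit c0 0 ! p = Some (\<lambda>r. (if b r then p + 1 else p + len c + 2, idle r))"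
    "p < len c0"
    using exec_CondT.prems(2)[of 0] exec_CondT.prems(1) by auto
  have **: "emit c0 0 ! (p + 1 + len c) = Some (\<lambda>r. (p + len c + len d + 2, idle r))"
    "p + 1 + len c < len c0"
    using exec_CondT.prems(2)[of "1 + len c"] exec_CondT.prems(1) by (auto simp: nth_append)
  have "reaches (machine N S c0 a) \<phi> (p, map \<sigma> [0..<N]) (p + 1, map \<sigma> [0..<N])"
    using step_machine[OF *(2,1), of \<phi> \<sigma>] exec_CondT.hyps(1)
    by (intro reaches_step) (simp add: idle_def heads_def)
  also have "reaches (machine N S c0 a) \<phi> (p + 1, map \<sigma> [0..<N])
      (p + 1 + len c, map \<sigma>' [0..<N])"
  proof (rule exec_CondT.IH)
    show "p + 1 + len c \<le> len c0" using exec_CondT.prems by simp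
    show "emit c0 0 ! (p + 1 + i) = emit c (p + 1) ! i" if "i < len c" for i
      using exec_CondT.prems(2)[of "1 + i"] that by (simp add: nth_append)
  qed
  also have "reaches (machine N S c0 a) \<phi> (p + 1 + len c, map \<sigma>' [0..<N])
      (p + len c + len d + 2, map \<sigma>' [0..<N])"
    using step_machine[OF **(2,1), of \<phi> \<sigma>']
    by (intro reaches_step) (simp add: idle_def heads_def)
  finally show ?case by (simp add: add.assoc)
next
  case (exec_CondF b \<sigma> d \<sigma>' c)
  have *: "emit c0 0 ! p = Some (\<lambda>r. (if b r then p + 1 else p + len c + 2, idle r))"
    "p < len c0"
    using exec_CondF.prems(2)[of 0] exec_CondF.prems(1) by auto
  have "reaches (machine N S c0 a) \<phi> (p, map \<sigma> [0..<N]) (p + len c + 2, map \<sigma> [0..<N])"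
    using step_machine[OF *(2,1), of \<phi> \<sigma>] exec_CondF.hyps(1)
    by (intro reaches_step) (simp add: idle_def heads_def)
  also have "reaches (machine N S c0 a) \<phi> (p + len c + 2, map \<sigma> [0..<N])
      (p + len c + 2 + len d, map \<sigma>' [0..<N])"
  proof (rule exec_CondF.IH)
    show "p + len c + 2 + len d \<le> len c0" using exec_CondF.prems by simp
    show "emit c0 0 ! (p + len c + 2 + i) = emit d (p + len c + 2) ! i" if "i < len d" for i
      using exec_CondF.prems(2)[of "len c + 2 + i"] that by (simp add: nth_append add_ac)
  qed
  finally show ?case by (simp add: add_ac)
next
  case (exec_WhileF b \<sigma> c)
  have *: "emit c0 0 ! p = Some (\<lambda>r. (if b r then p + 1 else p + len c + 2, idle r))"
    "p < len c0"
    using exec_WhileF.prems(2)[of 0] exec_WhileF.prems(1) by auto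
  show ?case
    using step_machine[OF *(2,1), of \<phi> \<sigma>] exec_WhileF.hyps(1)
    by (intro reaches_step) (simp add: idle_def heads_def)
next
  case (exec_WhileT b \<sigma> c \<sigma>' \<sigma>'')
  have *: "emit c0 0 ! p = Some (\<lambda>r. (if b r then p + 1 else p + len c + 2, idle r))"
    "p < len c0"
    using exec_WhileT.prems(2)[of 0] exec_WhileT.prems(1) by auto
  have **: "emit c0 0 ! (p + 1 + len c) = Some (\<lambda>r. (p, idle r))"
    "p + 1 + len c < len c0"
    using exec_WhileT.prems(2)[of "1 + len c"] exec_WhileT.prems(1) by (auto simp: nth_append)
  have "reaches (machine N S c0 a) \<phi> (p, map \<sigma> [0..<N]) (p + 1, map \<sigma> [0..<N])"
    using step_machine[OF *(2,1), of \<phi> \<sigma>] exec_WhileT.hyps(1)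
    by (intro reaches_step) (simp add: idle_def heads_def)
  also have "reaches (machine N S c0 a) \<phi> (p + 1, map \<sigma> [0..<N])
      (p + 1 + len c, map \<sigma>' [0..<N])"
  proof (rule exec_WhileT.IH(1))
    show "p + 1 + len c \<le> len c0" using exec_WhileT.prems by simp
    show "emit c0 0 ! (p + 1 + i) = emit c (p + 1) ! i" if "i < len c" for i
      using exec_WhileT.prems(2)[of "1 + i"] that by (simp add: nth_append)
  qed
  also have "reaches (machine N S c0 a) \<phi> (p + 1 + len c, map \<sigma>' [0..<N])
      (p, map \<sigma>' [0..<N])"
    using step_machine[OF **(2,1), of \<phi> \<sigma>']
    by (intro reaches_step) (simp add: idle_def heads_def)
  \<comment> \<open>The closing jump leads back to the start of the same loop, so the remaining
    rounds run on the same segment and need no new placement argument.\<close>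
  also have "reaches (machine N S c0 a) \<phi> (p, map \<sigma>' [0..<N])
      (p + len (While b c), map \<sigma>'' [0..<N])"
    using exec_WhileT.prems by (rule exec_WhileT.IH(2))
  finally show ?case .
qed

end

lemma num_tape_0: "num_tape 0 = blank_tape"
  by (auto simp: num_tape_def blank_tape_def)

lemma read_num_num_tape [simp]: "read_num (num_tape n) = n"
  unfolding read_num_def num_tape_def by (rule Least_equality) (auto split: if_splits)

text \<open>\<open>M\<close> is obtained before \<phi> and \<psi> are quantified; this order carries
  the uniformity of the final result.\<close>

lemma machine_of_program:
  assumes "wf_com N S c" "2 \<le> N" "2 \<le> S" "num_queries c = 1"
  obtains M where "oracle_machine M"
    "\<And>\<phi> \<psi>. (\<And>n. \<exists>\<sigma>. exec \<phi> c (num_tape \<circ> (\<lambda>_. 0)(0 := n)) \<sigma> \<and> \<sigma> 0 = num_tape (\<psi> n)) \<Longrightarrow>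
      computes M \<phi> \<psi>"
proof -
  obtain a where a: "a < len c" "\<And>i. i < len c \<Longrightarrow> emit c 0 ! i = None \<longleftrightarrow> i = a"
    using unique_query_address[OF assms(4)] by blast
  let ?M = "machine N S c a"
  show ?thesis
  proof (rule that[of ?M])
    show "oracle_machine ?M" using oracle_machine_machine assms a by blast
    fix \<phi> \<psi>
    assume ex: "\<And>n. \<exists>\<sigma>. exec \<phi> c (num_tape \<circ> (\<lambda>_. 0)(0 := n)) \<sigma> \<and> \<sigma> 0 = num_tape (\<psi> n)"
    show "computes ?M \<phi> \<psi>"
      unfolding computes_def
    proof
      fix n
      obtain \<sigma> where \<sigma>: "exec \<phi> c (num_tape \<circ> (\<lambda>_. 0)(0 := n)) \<sigma>" "\<sigma> 0 = num_tape (\<psi> n)"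
        using ex by blast
      have init: "init_config ?M n = (0, map (num_tape \<circ> (\<lambda>_. 0)(0 := n)) [0..<N])"
        using assms(2) by (auto simp: init_config_def machine_def num_tape_0 nth_Cons
            split: nat.splits intro!: nth_equalityI)
      have "reaches ?M \<phi> (init_config ?M n) (len c, map \<sigma> [0..<N])"
        using code_correct[OF assms(1,2) a(2) \<sigma>(1), of 0] init by simp
      then obtain k where "(step ?M \<phi> ^^ k) (init_config ?M n) = (len c, map \<sigma> [0..<N])"
        by (auto simp: reaches_def)
      then show "\<exists>k q ts. (step ?M \<phi> ^^ k) (init_config ?M n) = (q, ts) \<and>
          q = halt_state ?M \<and> read_num (ts ! 0) = \<psi> n"
        using \<sigma>(2) assms(2)
        by (intro exI[of _ k] exI[of _ "len c"] exI[of _ "map \<sigma> [0..<N]"]) (simp add: machine_def)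
    qed
  qed
qed


section \<open>Register programs\<close>

text \<open>\<open>\<rho> j\<close> is the store after \<open>j\<close> rounds. The execution is
  assembled backwards from the exit at \<open>n\<close>.\<close>

lemma exec_While:
  assumes "\<And>j. j < n \<Longrightarrow> b (heads (\<rho> j))"
    and "\<And>j. j < n \<Longrightarrow> exec \<phi> c (\<rho> j) (\<rho> (Suc j))"
    and "\<not> b (heads (\<rho> n))" and "\<rho> 0 = \<sigma>" and "\<rho> n = \<sigma>'"
  shows "exec \<phi> (While b c) \<sigma> \<sigma>'"
proof -
  have "exec \<phi> (While b c) (\<rho> j) (\<rho> n)" if "j \<le> n" for j
    using that
  proof (induction rule: inc_induct)
    case base
    then show ?case using assms(3) by (rule exec_WhileF)
  next
    case (step j)
    then show ?case using assms(1,2) by (blast intro: exec_WhileT)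
  qed
  then show ?thesis using assms(4,5) by auto
qed

text \<open>Each tape is exactly a unary number with nothing to the left of the head, so a test for
  zero reads a single cell.\<close>

definition run :: "(nat \<Rightarrow> nat) \<Rightarrow> com \<Rightarrow> (nat \<Rightarrow> nat) \<Rightarrow> (nat \<Rightarrow> nat) \<Rightarrow> bool" where
  "run \<phi> c R R' \<longleftrightarrow> exec \<phi> c (num_tape \<circ> R) (num_tape \<circ> R')"

lemma run_Seq [trans]: "run \<phi> c R R' \<Longrightarrow> run \<phi> d R' R'' \<Longrightarrow> run \<phi> (c ;; d) R R''"
  unfolding run_def by (rule exec_Seq)

lemma run_CondT: "b (heads (num_tape \<circ> R)) \<Longrightarrow> run \<phi> c R R' \<Longrightarrow> run \<phi> (Cond b c d) R R'"
  unfolding run_def by (rule exec_CondT)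

lemma run_CondF: "\<not> b (heads (num_tape \<circ> R)) \<Longrightarrow> run \<phi> d R R' \<Longrightarrow> run \<phi> (Cond b c d) R R'"
  unfolding run_def by (rule exec_CondF)

lemma run_While:
  assumes "\<And>j. j < n \<Longrightarrow> b (heads (num_tape \<circ> \<rho> j))"
    and "\<And>j. j < n \<Longrightarrow> run \<phi> c (\<rho> j) (\<rho> (Suc j))"
    and "\<not> b (heads (num_tape \<circ> \<rho> n))" and "\<rho> 0 = R" and "\<rho> n = R'"
  shows "run \<phi> (While b c) R R'"
  unfolding run_def
  by (rule exec_While[where \<rho> = "\<lambda>j. num_tape \<circ> \<rho> j" and n = n]) (use assms in \<open>simp_all add: run_def\<close>)

lemma heads_num_tape [simp]: "heads (num_tape \<circ> R) i = (if R i = 0 then 0 else 1)"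
  by (simp add: heads_def num_tape_def)

definition nonzero :: "nat \<Rightarrow> heads \<Rightarrow> bool" where
  "nonzero x r \<longleftrightarrow> r x \<noteq> 0"

definition dec :: "nat \<Rightarrow> com" where
  "dec x = Act (\<lambda>r. (idle r)(x := (0, MoveRight)))"

definition inc :: "nat \<Rightarrow> com" where
  "inc x = Act (\<lambda>r. (idle r)(x := (r x, MoveLeft))) ;; Act (\<lambda>r. (idle r)(x := (1, Stay)))"

definition clear :: "nat \<Rightarrow> com" where
  "clear x = While (nonzero x) (dec x)"

definition move :: "nat \<Rightarrow> nat \<Rightarrow> com" where
  "move x y = While (nonzero x) (dec x ;; inc y)"

definition move2 :: "nat \<Rightarrow> nat \<Rightarrow> nat \<Rightarrow> com" where
  "move2 x y z = While (nonzero x) (dec x ;; inc y ;; inc z)"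

definition cancel :: "nat \<Rightarrow> nat \<Rightarrow> com" where
  "cancel x y = While (\<lambda>r. r x \<noteq> 0 \<and> r y \<noteq> 0) (dec x ;; dec y)"

text \<open>
  Walks along the diagonals of the Cantor pairing: \<open>(a, b + 1)\<close> is followed by \<open>(a + 1, b)\<close>, and
  \<open>(a, 0)\<close> by \<open>(0, a + 1)\<close>.
\<close>

definition decode :: "nat \<Rightarrow> nat \<Rightarrow> nat \<Rightarrow> com" where
  "decode x y z = While (nonzero x)
     (dec x ;; Cond (nonzero z) (dec z ;; inc y) (inc z ;; move y z))"

text \<open>The first stroke is erased before the head moves on, so no garbage remains on the left.
  A blank tape stays blank, in accordance with truncated subtraction.\<close>

lemma num_tape_dec: "act (0, MoveRight) (num_tape n) = num_tape (n - 1)"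
  by (auto simp: act_def num_tape_def fun_eq_iff)

lemma num_tape_inc:
  "act (1, Stay) (act (num_tape n 0, MoveLeft) (num_tape n)) = num_tape (Suc n)"
  by (auto simp: act_def num_tape_def fun_eq_iff)

section \<open>Correctness of the register operations\<close>

lemma exec_ActI: "(\<And>i. act (f (heads \<sigma>) i) (\<sigma> i) = \<sigma>' i) \<Longrightarrow> exec \<phi> (Act f) \<sigma> \<sigma>'"
  using exec_Act[of \<phi> f \<sigma>] by (subst (asm) ext[of _ \<sigma>']) auto

text \<open>Only tape \<open>x\<close> has to hold a number: inside a subroutine call the other
  tapes may carry arbitrary symbols.\<close>

lemma exec_dec:
  assumes "\<sigma> x = num_tape n"
  shows "exec \<phi> (dec x) \<sigma> (\<sigma>(x := num_tape (n - 1)))"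
  unfolding dec_def using assms
  by (intro exec_ActI) (simp add: idle_def heads_def num_tape_dec del: One_nat_def)

lemma exec_inc:
  assumes "\<sigma> x = num_tape n"
  shows "exec \<phi> (inc x) \<sigma> (\<sigma>(x := num_tape (Suc n)))"
proof -
  let ?\<sigma> = "\<sigma>(x := act (num_tape n 0, MoveLeft) (num_tape n))"
  have "exec \<phi> (Act (\<lambda>r. (idle r)(x := (r x, MoveLeft)))) \<sigma> ?\<sigma>"
    using assms by (intro exec_ActI) (simp add: idle_def heads_def)
  moreover have "exec \<phi> (Act (\<lambda>r. (idle r)(x := (1, Stay)))) ?\<sigma> (\<sigma>(x := num_tape (Suc n)))"
    by (intro exec_ActI) (simp add: idle_def heads_def num_tape_inc[simplified])
  ultimately show ?thesis unfolding inc_def by (rule exec_Seq)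
qed

lemma run_dec: "R' = R(x := R x - 1) \<Longrightarrow> run \<phi> (dec x) R R'"
  using exec_dec[of "num_tape \<circ> R" x "R x" \<phi>] by (simp add: run_def fun_upd_comp)

lemma run_inc: "R' = R(x := Suc (R x)) \<Longrightarrow> run \<phi> (inc x) R R'"
  using exec_inc[of "num_tape \<circ> R" x "R x" \<phi>] by (simp add: run_def fun_upd_comp)

lemma run_Query: "R' = R(1 := \<phi> (R 1)) \<Longrightarrow> run \<phi> Query R R'"
  using exec_Query[of \<phi> "num_tape \<circ> R"] by (simp add: run_def fun_upd_comp)

lemma run_clear:
  assumes "R' = R(x := 0)"
  shows "run \<phi> (clear x) R R'"
  unfolding clear_def
proof (rule run_While[where n = "R x" and \<rho> = "\<lambda>j. R(x := R x - j)"])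
  fix j
  show "run \<phi> (dec x) (R(x := R x - j)) (R(x := R x - Suc j))"
    by (rule run_dec) simp
qed (auto simp: nonzero_def assms)

lemma run_move:
  assumes "x \<noteq> y" "R' = R(x := 0, y := R y + R x)"
  shows "run \<phi> (move x y) R R'"
  unfolding move_def
proof (rule run_While[where n = "R x" and \<rho> = "\<lambda>j. R(x := R x - j, y := R y + j)"])
  fix j
  show "run \<phi> (dec x ;; inc y) (R(x := R x - j, y := R y + j)) (R(x := R x - Suc j, y := R y + Suc j))"
    by (rule run_Seq[OF run_dec[OF refl] run_inc]) (use assms(1) in \<open>auto simp: fun_eq_iff\<close>)
qed (use assms in \<open>auto simp: nonzero_def\<close>)

lemma run_move2:
  assumes "x \<noteq> y" "x \<noteq> z" "y \<noteq> z" "R' = R(x := 0, y := R y + R x, z := R z + R x)"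
  shows "run \<phi> (move2 x y z) R R'"
  unfolding move2_def
proof (rule run_While[where n = "R x" and \<rho> = "\<lambda>j. R(x := R x - j, y := R y + j, z := R z + j)"])
  fix j
  let ?R = "R(x := R x - j, y := R y + j, z := R z + j)"
  show "run \<phi> (dec x ;; inc y ;; inc z) ?R (R(x := R x - Suc j, y := R y + Suc j, z := R z + Suc j))"
    by (rule run_Seq[OF run_dec[OF refl] run_Seq[OF run_inc[OF refl] run_inc]])
      (use assms(1-3) in \<open>auto simp: fun_eq_iff\<close>)
qed (use assms in \<open>auto simp: nonzero_def\<close>)

text \<open>Removing strokes in pairs stops after the minimum of both numbers. What remains are the
  two truncated differences, and both vanish exactly for equal numbers; this is how the search tests
  equality.\<close>

lemma run_cancel:
  assumes "x \<noteq> y" "R' = R(x := R x - R y, y := R y - R x)"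
  shows "run \<phi> (cancel x y) R R'"
  unfolding cancel_def
proof (rule run_While[where n = "min (R x) (R y)" and \<rho> = "\<lambda>j. R(x := R x - j, y := R y - j)"])
  fix j
  show "run \<phi> (dec x ;; dec y) (R(x := R x - j, y := R y - j)) (R(x := R x - Suc j, y := R y - Suc j))"
    by (rule run_Seq[OF run_dec[OF refl] run_dec]) (use assms(1) in \<open>auto simp: fun_eq_iff\<close>)
next
  show "R(x := R x - min (R x) (R y), y := R y - min (R x) (R y)) = R'"
    using assms by (auto simp: min_def fun_eq_iff)
qed (use assms in auto)

text \<open>\<open>prod_encode (a, b)\<close> is the triangular number of \<open>a + b\<close> plus
  \<open>a\<close>: within a diagonal the code grows with \<open>a\<close>, and
  \<open>(a, 0)\<close> is the last entry of its diagonal.\<close>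

lemma prod_decode_Suc:
  "prod_decode (Suc n) = (let (a, b) = prod_decode n in if b = 0 then (0, Suc a) else (Suc a, b - 1))"
proof -
  obtain a b where ab: "prod_decode n = (a, b)" by force
  then have n: "n = prod_encode (a, b)" by (metis prod_decode_inverse)
  have "Suc n = prod_encode (if b = 0 then (0, Suc a) else (Suc a, b - 1))"
    by (cases b) (simp_all add: n prod_encode_def)
  then have "prod_decode (Suc n) = (if b = 0 then (0, Suc a) else (Suc a, b - 1))"
    by (simp only: prod_encode_inverse)
  then show ?thesis using ab by simp
qed

lemma run_decode:
  assumes "x \<noteq> y" "x \<noteq> z" "y \<noteq> z" "R y = 0" "R z = 0"
    and "R' = R(x := 0, y := fst (prod_decode (R x)), z := snd (prod_decode (R x)))"
  shows "run \<phi> (decode x y z) R R'"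
  unfolding decode_def
proof (rule run_While[where n = "R x" and
      \<rho> = "\<lambda>j. R(x := R x - j, y := fst (prod_decode j), z := snd (prod_decode j))"])
  fix j
  obtain a b where ab: "prod_decode j = (a, b)" by force
  let ?R = "R(x := R x - j, y := a, z := b)"
  let ?R1 = "R(x := R x - Suc j, y := a, z := b)"
  let ?R' = "R(x := R x - Suc j, y := fst (prod_decode (Suc j)), z := snd (prod_decode (Suc j)))"
  let ?body = "Cond (nonzero z) (dec z ;; inc y) (inc z ;; move y z)"
  have dec: "run \<phi> (dec x) ?R ?R1"
    by (rule run_dec) (use assms(1-5) in \<open>auto simp: fun_eq_iff\<close>)
  have "run \<phi> ?body ?R1 ?R'"
  proof (cases "b = 0")
    case True
    \<comment> \<open>At the end of a diagonal \<open>z\<close> is 0 and \<open>y\<close> is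
      \<open>a\<close>; one stroke plus the moved ones gives \<open>a + 1\<close> on
      \<open>z\<close>.\<close>
    have "run \<phi> (inc z ;; move y z) ?R1 ?R'"
      by (rule run_Seq[OF run_inc[OF refl] run_move])
        (use assms(1-5) ab True in \<open>auto simp: fun_eq_iff prod_decode_Suc\<close>)
    then show ?thesis using True by (intro run_CondF) (simp_all add: nonzero_def)
  next
    case False
    have "run \<phi> (dec z ;; inc y) ?R1 ?R'"
      by (rule run_Seq[OF run_dec[OF refl] run_inc])
        (use assms(1-5) ab False in \<open>auto simp: fun_eq_iff prod_decode_Suc\<close>)
    then show ?thesis using False by (intro run_CondT) (simp_all add: nonzero_def)
  qed
  with dec have "run \<phi> (dec x ;; ?body) ?R ?R'" by (rule run_Seq)
  then show "run \<phi> (dec x ;; ?body)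
    (R(x := R x - j, y := fst (prod_decode j), z := snd (prod_decode j))) ?R'"
    by (simp add: ab)
next
  have "prod_decode 0 = (0, 0)" by (simp add: prod_decode_def prod_decode_aux.simps)
  then show "R(x := R x - 0, y := fst (prod_decode 0), z := snd (prod_decode 0)) = R"
    using assms by auto
qed (use assms in \<open>auto simp: nonzero_def\<close>)

section \<open>Bounds for the register operations\<close>

lemma local_test_nonzero: "x < N \<Longrightarrow> local_test N (nonzero x)"
  by (simp add: local_test_def nonzero_def)

lemma wf_dec: "x < N \<Longrightarrow> 2 \<le> S \<Longrightarrow> wf_com N S (dec x)"
  by (auto simp: dec_def local_act_def bounded_act_def idle_def)

lemma wf_inc: "x < N \<Longrightarrow> 2 \<le> S \<Longrightarrow> wf_com N S (inc x)"
  by (auto simp: inc_def local_act_def bounded_act_def idle_def)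

lemma wf_macros:
  assumes "2 \<le> S"
  shows "x < N \<Longrightarrow> wf_com N S (clear x)"
    "x < N \<Longrightarrow> y < N \<Longrightarrow> wf_com N S (move x y)"
    "x < N \<Longrightarrow> y < N \<Longrightarrow> z < N \<Longrightarrow> wf_com N S (move2 x y z)"
    "x < N \<Longrightarrow> y < N \<Longrightarrow> wf_com N S (cancel x y)"
    "x < N \<Longrightarrow> y < N \<Longrightarrow> z < N \<Longrightarrow> wf_com N S (decode x y z)"
  using assms
  by (simp_all add: clear_def move_def move2_def cancel_def decode_def
      local_test_nonzero wf_dec wf_inc) (simp add: local_test_def)

lemma num_queries_macros [simp]:
  "num_queries (dec x) = 0" "num_queries (inc x) = 0" "num_queries (clear x) = 0"
  "num_queries (move x y) = 0" "num_queries (move2 x y z) = 0" "num_queries (cancel x y) = 0"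
  "num_queries (decode x y z) = 0"
  by (simp_all add: dec_def inc_def clear_def move_def move2_def cancel_def decode_def)


section \<open>Simulating an oracle-free machine\<close>

text \<open>\<open>K\<close> bounds the distance of non-blank cells from the current head. As head
  moves are shifts of the tape, one step enlarges this distance by at most one.\<close>

definition valid :: "otm \<Rightarrow> nat \<Rightarrow> config \<Rightarrow> bool" where
  "valid M K c \<longleftrightarrow> fst c < n_states M \<and> fst c \<noteq> query_state M \<and> length (snd c) = n_tapes M \<and>
     (\<forall>t\<in>set (snd c). (\<forall>i. t i < n_symbols M) \<and> (\<forall>i. int K < \<bar>i\<bar> \<longrightarrow> t i = 0))"

lemma act_symbols: "\<forall>i. t i < S \<Longrightarrow> fst a < S \<Longrightarrow> act a t i < S"
  by (cases "snd a") (auto simp: act_def)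

lemma act_support:
  assumes "\<forall>i. int K < \<bar>i\<bar> \<longrightarrow> t i = 0" "int (Suc K) < \<bar>i\<bar>"
  shows "act a t i = 0"
  using assms by (cases "snd a") (auto simp: act_def)

lemma oracle_machine_delta:
  assumes "oracle_machine M" "q < n_states M" "length ss = n_tapes M" "\<forall>s\<in>set ss. s < n_symbols M"
    and "delta M q ss = (q', as)"
  shows "q' < n_states M" "length as = n_tapes M" "\<forall>a\<in>set as. fst a < n_symbols M"
proof -
  have "fst (delta M q ss) < n_states M \<and> length (snd (delta M q ss)) = n_tapes M \<and>
    (\<forall>a\<in>set (snd (delta M q ss)). fst a < n_symbols M)"
    using assms(1-4) unfolding oracle_machine_def by blast
  then show "q' < n_states M" "length as = n_tapes M" "\<forall>a\<in>set as. fst a < n_symbols M"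
    unfolding assms(5) by simp_all
qed

lemma oracle_free_delta:
  assumes "oracle_free M" "q < n_states M" "length ss = n_tapes M" "\<forall>s\<in>set ss. s < n_symbols M"
    and "delta M q ss = (q', as)"
  shows "q' \<noteq> query_state M"
proof -
  have "fst (delta M q ss) \<noteq> query_state M"
    using assms(1-4) unfolding oracle_free_def by blast
  then show ?thesis unfolding assms(5) by simp
qed

lemma valid_init:
  assumes "oracle_machine M" "oracle_free M"
  shows "valid M n (init_config M n)"
  using assms by (auto simp: valid_def init_config_def oracle_machine_def oracle_free_def
      num_tape_def blank_tape_def)

lemma valid_step:
  assumes M: "oracle_machine M" "oracle_free M" and valid: "valid M K c"
  shows "valid M (Suc K) (step M \<phi> c)"
proof -
  obtain q ts where c: "c = (q, ts)" by force
  have q: "q < n_states M" "q \<noteq> query_state M" and len: "length ts = n_tapes M"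
    and sym: "\<And>t i. t \<in> set ts \<Longrightarrow> t i < n_symbols M"
    and supp: "\<And>t i. t \<in> set ts \<Longrightarrow> int K < \<bar>i\<bar> \<Longrightarrow> t i = 0"
    using valid by (auto simp: valid_def c)
  show ?thesis
  proof (cases "q = halt_state M")
    case True
    then show ?thesis using valid by (auto simp: valid_def c step_def)
  next
    case False
    let ?ss = "map (\<lambda>t. t 0) ts"
    obtain q' as where d: "delta M q ?ss = (q', as)" by force
    have ss: "length ?ss = n_tapes M" "\<forall>s\<in>set ?ss. s < n_symbols M"
      using len sym by auto
    note as = oracle_machine_delta[OF M(1) q(1) ss d]
    have act: "act a t i < n_symbols M" "int (Suc K) < \<bar>i\<bar> \<longrightarrow> act a t i = 0"
      if "(a, t) \<in> set (zip as ts)" for a t i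
    proof -
      have "a \<in> set as" "t \<in> set ts" using that by (auto dest: set_zip_leftD set_zip_rightD)
      then show "act a t i < n_symbols M" "int (Suc K) < \<bar>i\<bar> \<longrightarrow> act a t i = 0"
        using as(3) sym supp act_symbols[of t "n_symbols M" a i] act_support[of K t i a] by blast+
    qed
    have "step M \<phi> c = (q', map2 act as ts)"
      using False q(2) d by (simp add: c step_def)
    moreover have "length (map2 act as ts) = n_tapes M" using as(2) len by simp
    moreover have "q' \<noteq> query_state M" by (rule oracle_free_delta[OF M(2) q(1) ss d])
    ultimately show ?thesis
      using as(1) act by (auto simp: valid_def)
  qed
qed

text \<open>The bound \<open>n + j\<close> is the number that tape 10 holds after \<open>j\<close>
  simulated steps on input \<open>n\<close>.\<close>

lemma valid_steps:
  assumes "oracle_machine M" "oracle_free M"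
  shows "valid M (n + j) ((step M \<phi> ^^ j) (init_config M n))"
  by (induction j) (use valid_init valid_step assms in auto)

text \<open>
  The subroutine for a machine holds the state as a symbol on tape 9, counts on tape 10 in order to
  bound the cells that have to be erased afterwards, uses tape 11 as scratch register, and keeps the
  tapes of the machine at 12 and above.
\<close>

definition sim_step :: "otm \<Rightarrow> heads \<Rightarrow> actions" where
  "sim_step M r = (let ss = map (\<lambda>i. r (12 + i)) [0..<n_tapes M]; d = delta M (r 9) ss in
     if r 9 < n_states M \<and> (\<forall>s\<in>set ss. s < n_symbols M)
     then (\<lambda>i. if i = 9 then (fst d, Stay)
       else if 12 \<le> i \<and> i < 12 + n_tapes M then snd d ! (i - 12) else (r i, Stay))
     else idle r)"

definition set_state :: "nat \<Rightarrow> heads \<Rightarrow> actions" where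
  "set_state q r = (idle r)(9 := (q, Stay))"

definition block_left :: "nat \<Rightarrow> heads \<Rightarrow> actions" where
  "block_left n r = (\<lambda>i. (r i, if 12 \<le> i \<and> i < 12 + n then MoveLeft else Stay))"

definition block_erase :: "nat \<Rightarrow> heads \<Rightarrow> actions" where
  "block_erase n r = (\<lambda>i. if 12 \<le> i \<and> i < 12 + n then (0, MoveRight) else (r i, Stay))"

text \<open>With \<open>K\<close> on tape 10, the heads go \<open>K\<close> cells to the left while
  tape 11 collects \<open>2 * K\<close>. The extra stroke makes it \<open>2 * K + 1\<close>, the
  number of cells from \<open>- K\<close> to \<open>K\<close>.\<close>

definition erase_block :: "nat \<Rightarrow> com" where
  "erase_block n =
     While (nonzero 10) (dec 10 ;; inc 11 ;; inc 11 ;; Act (block_left n)) ;;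
     inc 11 ;; While (nonzero 11) (dec 11 ;; Act (block_erase n))"

text \<open>Reading the output shifts tape 12 under the head, so each stroke read also raises the
  bound on tape 10.\<close>

definition copy_output :: "nat \<Rightarrow> com" where
  "copy_output y = While (\<lambda>r. r 12 = 1) (Act (\<lambda>r. (idle r)(12 := (r 12, MoveRight))) ;; inc y ;; inc 10)"

definition call :: "otm \<Rightarrow> nat \<Rightarrow> nat \<Rightarrow> com" where
  "call M x y = move2 x 12 10 ;; Act (set_state (start_state M)) ;;
     While (\<lambda>r. r 9 \<noteq> halt_state M) (Act (sim_step M) ;; inc 10) ;;
     copy_output y ;; Act (set_state 0) ;; erase_block (n_tapes M)"

text \<open>The oracle tape of the simulated machine lies at 13, so the genuine oracle tape 1
  survives a call.\<close>

definition with_config :: "store \<Rightarrow> config \<Rightarrow> store" where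
  "with_config \<sigma> c = (\<lambda>i. if i = 9 then blank_tape(0 := fst c)
     else if 12 \<le> i \<and> i < 12 + length (snd c) then snd c ! (i - 12) else \<sigma> i)"

section \<open>Correctness of the subroutine\<close>

lemma act_Stay [simp]: "act (s, Stay) t = t(0 := s)"
  by (simp add: act_def)

lemma exec_sim_step:
  assumes "valid M K c" "fst c \<noteq> halt_state M" "oracle_machine M"
  shows "exec \<phi> (Act (sim_step M)) (with_config \<sigma> c) (with_config \<sigma> (step M \<psi> c))"
proof -
  obtain q ts where c: "c = (q, ts)" by force
  have q: "q < n_states M" "q \<noteq> query_state M" "q \<noteq> halt_state M" and len: "length ts = n_tapes M"
    and sym: "\<And>t i. t \<in> set ts \<Longrightarrow> t i < n_symbols M"
    using assms by (auto simp: valid_def c)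
  let ?r = "heads (with_config \<sigma> (q, ts))"
  let ?ss = "map (\<lambda>t. t 0) ts"
  obtain q' as where d: "delta M q ?ss = (q', as)" by force
  have "length ?ss = n_tapes M" "\<forall>s\<in>set ?ss. s < n_symbols M"
    using len sym by auto
  note as = oracle_machine_delta(2)[OF assms(3) q(1) this d]
  have ss: "map (\<lambda>i. ?r (12 + i)) [0..<n_tapes M] = ?ss"
    by (intro nth_equalityI) (auto simp: heads_def with_config_def len)
  have r9: "?r 9 = q" by (simp add: heads_def with_config_def)
  have "sim_step M ?r = (\<lambda>i. if i = 9 then (q', Stay)
       else if 12 \<le> i \<and> i < 12 + n_tapes M then as ! (i - 12) else (?r i, Stay))"
    unfolding sim_step_def Let_def ss r9 d using q sym by auto
  then show ?thesis
    unfolding c using q d len as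
    by (intro exec_ActI) (auto simp: step_def with_config_def heads_def)
qed

text \<open>\<psi> is the oracle of the simulated run, \<phi> that of the simulating program. They
  are unrelated, because an oracle-free \<open>M\<close> never reaches its query state.\<close>

lemma exec_simulation:
  assumes M: "oracle_machine M" "oracle_free M" and "\<sigma> 10 = num_tape n"
    and halts: "fst ((step M \<psi> ^^ k) (init_config M n)) = halt_state M"
  obtains j where "fst ((step M \<psi> ^^ j) (init_config M n)) = halt_state M"
    "exec \<phi> (While (\<lambda>r. r 9 \<noteq> halt_state M) (Act (sim_step M) ;; inc 10))
       (with_config \<sigma> (init_config M n))
       (with_config (\<sigma>(10 := num_tape (n + j))) ((step M \<psi> ^^ j) (init_config M n)))"
proof -
  define C where "C j = (step M \<psi> ^^ j) (init_config M n)" for j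
  \<comment> \<open>The loop is left at the first halting time, which may precede the given
    \<open>k\<close>.\<close>
  define j where "j = (LEAST j. fst (C j) = halt_state M)"
  have j: "fst (C j) = halt_state M" unfolding j_def by (rule LeastI[of _ k]) (use halts C_def in simp)
  have less: "fst (C i) \<noteq> halt_state M" if "i < j" for i
    using that not_less_Least unfolding j_def by blast
  have valid: "valid M (n + i) (C i)" for i unfolding C_def by (rule valid_steps[OF M])
  have h9: "heads (with_config \<sigma>' c) 9 = fst c" for \<sigma>' c
    by (simp add: heads_def with_config_def)
  have "exec \<phi> (While (\<lambda>r. r 9 \<noteq> halt_state M) (Act (sim_step M) ;; inc 10))
       (with_config \<sigma> (C 0)) (with_config (\<sigma>(10 := num_tape (n + j))) (C j))"
  proof (rule exec_While[where n = j and \<rho> = "\<lambda>i. with_config (\<sigma>(10 := num_tape (n + i))) (C i)"])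
    fix i assume "i < j"
    then show "heads (with_config (\<sigma>(10 := num_tape (n + i))) (C i)) 9 \<noteq> halt_state M"
      using less by (simp add: h9)
    let ?\<sigma> = "\<sigma>(10 := num_tape (n + i))"
    have "exec \<phi> (Act (sim_step M)) (with_config ?\<sigma> (C i)) (with_config ?\<sigma> (C (Suc i)))"
      using exec_sim_step[OF valid less[OF \<open>i < j\<close>] M(1)] by (simp add: C_def)
    moreover have "with_config ?\<sigma> (C (Suc i)) 10 = num_tape (n + i)"
      by (simp add: with_config_def)
    then have "exec \<phi> (inc 10) (with_config ?\<sigma> (C (Suc i)))
        ((with_config ?\<sigma> (C (Suc i)))(10 := num_tape (Suc (n + i))))"
      by (rule exec_inc)
    moreover have "(with_config ?\<sigma> (C (Suc i)))(10 := num_tape (Suc (n + i))) =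
        with_config (\<sigma>(10 := num_tape (n + Suc i))) (C (Suc i))"
      by (auto simp: with_config_def)
    ultimately show "exec \<phi> (Act (sim_step M) ;; inc 10) (with_config ?\<sigma> (C i))
        (with_config (\<sigma>(10 := num_tape (n + Suc i))) (C (Suc i)))"
      by (auto intro: exec_Seq)
  next
    show "with_config (\<sigma>(10 := num_tape (n + 0))) (C 0) = with_config \<sigma> (C 0)"
      using assms(3) by (simp add: fun_upd_idem)
  qed (simp_all add: h9 j)
  then show ?thesis using j by (intro that[of j]) (simp_all add: C_def)
qed

lemma act_MoveRight_shift:
  "act (t (int j), MoveRight) (\<lambda>i. t (i + int j)) = (\<lambda>i. t (i + int (Suc j)))"
proof
  fix i :: int
  have "i + 1 + int j = i + int (Suc j)" by simp
  moreover have "t (int j) = t (i + int (Suc j))" if "i + 1 = 0"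
  proof -
    have "i = - 1" using that by simp
    then show ?thesis by simp
  qed
  ultimately show "act (t (int j), MoveRight) (\<lambda>i. t (i + int j)) i = t (i + int (Suc j))"
    by (auto simp only: act_def fst_conv snd_conv move_head.simps fun_upd_apply split: if_split)
qed

lemma exec_copy_output:
  assumes "\<sigma> 10 = num_tape K" "\<sigma> y = num_tape v" "y < 9" "\<sigma> 12 = t" "t (int N) \<noteq> 1"
  shows "exec \<phi> (copy_output y) \<sigma> (\<sigma>(12 := \<lambda>i. t (i + int (read_num t)),
    y := num_tape (v + read_num t), 10 := num_tape (K + read_num t)))"
  unfolding copy_output_def
proof (rule exec_While[where n = "read_num t" and \<rho> = "\<lambda>j. \<sigma>(12 := \<lambda>i. t (i + int j),
    y := num_tape (v + j), 10 := num_tape (K + j))"])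
  let ?\<rho> = "\<lambda>j. \<sigma>(12 := \<lambda>i. t (i + int j), y := num_tape (v + j), 10 := num_tape (K + j))"
  have h12: "heads (?\<rho> j) 12 = t (int j)" for j
    using assms(3) by (simp add: heads_def)
  fix j assume j: "j < read_num t"
  then show "heads (?\<rho> j) 12 = 1"
    unfolding h12 read_num_def using not_less_Least by blast
  let ?a = "(?\<rho> j)(12 := \<lambda>i. t (i + int (Suc j)))"
  note shift = act_MoveRight_shift[of t j]
  have "exec \<phi> (Act (\<lambda>r. (idle r)(12 := (r 12, MoveRight)))) (?\<rho> j) ?a"
  proof (rule exec_ActI)
    fix i
    show "act (((idle (heads (?\<rho> j)))(12 := (heads (?\<rho> j) 12, MoveRight))) i) (?\<rho> j i) = ?a i"
      using assms(3) shift unfolding h12 by (cases "i = 12") (auto simp: idle_def heads_def)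
  qed
  moreover have "exec \<phi> (inc y) ?a (?a(y := num_tape (Suc (v + j))))"
    by (rule exec_inc) (use assms(3) in simp)
  moreover have "exec \<phi> (inc 10) (?a(y := num_tape (Suc (v + j))))
      (?a(y := num_tape (Suc (v + j)), 10 := num_tape (Suc (K + j))))"
    by (rule exec_inc) (use assms(3) in simp)
  moreover have "?a(y := num_tape (Suc (v + j)), 10 := num_tape (Suc (K + j))) = ?\<rho> (Suc j)"
    using assms(3) by (auto simp: fun_eq_iff)
  ultimately show "exec \<phi> (Act (\<lambda>r. (idle r)(12 := (r 12, MoveRight))) ;; inc y ;; inc 10) (?\<rho> j) (?\<rho> (Suc j))"
    by (auto intro: exec_Seq)
next
  \<comment> \<open>A cell without a stroke exists by assumption, so the \<open>LEAST\<close> in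
    \<open>read_num\<close> is attained and the loop ends there.\<close>
  have "t (int (read_num t)) \<noteq> 1"
    unfolding read_num_def by (rule LeastI[of _ N]) (rule assms(5))
  then show "heads (\<sigma>(12 := \<lambda>i. t (i + int (read_num t)),
      y := num_tape (v + read_num t), 10 := num_tape (K + read_num t))) 12 \<noteq> 1"
    using assms(3) by (simp add: heads_def)
next
  show "\<sigma>(12 := \<lambda>i. t (i + int 0), y := num_tape (v + 0), 10 := num_tape (K + 0)) = \<sigma>"
    using assms(1-4) by (intro ext) simp
qed (rule refl)

lemma exec_erase_block:
  assumes "\<sigma> 10 = num_tape K" "\<sigma> 11 = blank_tape"
    and "\<And>i j. 12 \<le> i \<Longrightarrow> i < 12 + n \<Longrightarrow> int K < \<bar>j\<bar> \<Longrightarrow> \<sigma> i j = 0"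
  shows "exec \<phi> (erase_block n) \<sigma>
    (\<lambda>i. if i = 10 \<or> 12 \<le> i \<and> i < 12 + n then blank_tape else \<sigma> i)"
proof -
  \<comment> \<open>\<open>\<rho> j\<close> is the store after \<open>j\<close> moves to the left,
    and \<open>\<eta> j\<close> the one after \<open>j\<close> erasures. In \<open>\<eta>\<close>
    everything left of the head is blank.\<close>
  define \<rho> where "\<rho> j = (\<lambda>i. if i = 10 then num_tape (K - j) else if i = 11 then num_tape (2 * j)
    else if 12 \<le> i \<and> i < 12 + n then (\<lambda>m. \<sigma> i (m - int j)) else \<sigma> i)" for j
  define \<eta> where "\<eta> j = (\<lambda>i. if i = 10 then blank_tape else if i = 11 then num_tape (2 * K + 1 - j)
    else if 12 \<le> i \<and> i < 12 + n then (\<lambda>m. if m < 0 then 0 else \<sigma> i (m + int j - int K)) else \<sigma> i)" for j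
  have "exec \<phi> (While (nonzero 10) (dec 10 ;; inc 11 ;; inc 11 ;; Act (block_left n))) \<sigma> (\<rho> K)"
  proof (rule exec_While[where n = K and \<rho> = \<rho>])
    fix j assume j: "j < K"
    then show "nonzero 10 (heads (\<rho> j))" by (simp add: nonzero_def heads_def \<rho>_def num_tape_def)
    let ?a = "(\<rho> j)(10 := num_tape (K - j - 1))"
    let ?b = "?a(11 := num_tape (Suc (2 * j)))"
    let ?c = "?b(11 := num_tape (Suc (Suc (2 * j))))"
    have "exec \<phi> (dec 10) (\<rho> j) ?a" by (rule exec_dec) (simp add: \<rho>_def)
    moreover have "exec \<phi> (inc 11) ?a ?b" by (rule exec_inc) (simp add: \<rho>_def)
    moreover have "exec \<phi> (inc 11) ?b ?c" by (rule exec_inc) simp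
    moreover have "exec \<phi> (Act (block_left n)) ?c (\<rho> (Suc j))"
      by (intro exec_ActI) (auto simp: block_left_def heads_def act_def \<rho>_def fun_eq_iff algebra_simps)
    ultimately show "exec \<phi> (dec 10 ;; inc 11 ;; inc 11 ;; Act (block_left n)) (\<rho> j) (\<rho> (Suc j))"
      by (blast intro: exec_Seq)
  next
    show "\<rho> 0 = \<sigma>" using assms(1,2) by (auto simp: \<rho>_def num_tape_0)
  qed (simp_all add: nonzero_def heads_def \<rho>_def num_tape_def)
  moreover have "exec \<phi> (inc 11) (\<rho> K) (\<eta> 0)"
  proof -
    have "exec \<phi> (inc 11) (\<rho> K) ((\<rho> K)(11 := num_tape (Suc (2 * K))))"
      by (rule exec_inc) (simp add: \<rho>_def)
    \<comment> \<open>The heads now stand at the original cell \<open>- K\<close>, and the cells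
      farther left are blank by the assumed bound.\<close>
    moreover have "(\<rho> K)(11 := num_tape (Suc (2 * K))) = \<eta> 0"
      using assms(3) by (auto simp: \<rho>_def \<eta>_def fun_eq_iff num_tape_0)
    ultimately show ?thesis by simp
  qed
  moreover have "exec \<phi> (While (nonzero 11) (dec 11 ;; Act (block_erase n))) (\<eta> 0) (\<eta> (2 * K + 1))"
  proof (rule exec_While[where n = "2 * K + 1" and \<rho> = \<eta>])
    fix j assume j: "j < 2 * K + 1"
    then show "nonzero 11 (heads (\<eta> j))" by (simp add: nonzero_def heads_def \<eta>_def num_tape_def)
    let ?a = "(\<eta> j)(11 := num_tape (2 * K + 1 - j - 1))"
    have "exec \<phi> (dec 11) (\<eta> j) ?a" by (rule exec_dec) (simp add: \<eta>_def)
    moreover have "exec \<phi> (Act (block_erase n)) ?a (\<eta> (Suc j))"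
      by (intro exec_ActI) (auto simp: block_erase_def heads_def act_def \<eta>_def fun_eq_iff algebra_simps)
    ultimately show "exec \<phi> (dec 11 ;; Act (block_erase n)) (\<eta> j) (\<eta> (Suc j))"
      by (rule exec_Seq)
  qed (simp_all add: nonzero_def heads_def \<eta>_def num_tape_def)
  moreover have "\<eta> (2 * K + 1) = (\<lambda>i. if i = 10 \<or> 12 \<le> i \<and> i < 12 + n then blank_tape else \<sigma> i)"
    using assms(2,3) by (auto simp: \<eta>_def fun_eq_iff num_tape_0 blank_tape_def)
  ultimately show ?thesis unfolding erase_block_def by (auto intro!: exec_Seq)
qed

lemma init_config_eq:
  assumes "2 \<le> n_tapes M"
  shows "init_config M n =
    (start_state M, map (\<lambda>i. if i = 0 then num_tape n else blank_tape) [0..<n_tapes M])"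
  using assms by (auto simp: init_config_def nth_Cons split: nat.splits intro!: nth_equalityI)

text \<open>The contract that permits repeated calls: all tapes from 9 on are blank before and
  after.\<close>

lemma run_call:
  assumes M: "oracle_machine M" "oracle_free M" "computes M (\<lambda>_. 0) f"
    and xy: "x < 9" "y < 9" "x \<noteq> y" and R: "\<And>i. 9 \<le> i \<Longrightarrow> R i = 0"
    and R': "R' = R(x := 0, y := R y + f (R x))"
  shows "run \<phi> (call M x y) R R'"
proof -
  define n where "n = R x"
  define C where "C j = (step M (\<lambda>_. 0) ^^ j) (init_config M n)" for j
  have N: "2 \<le> n_tapes M" using M(1) by (simp add: oracle_machine_def)
  define \<sigma> where "\<sigma> = num_tape \<circ> R(x := 0, 10 := n)"
  obtain k where k: "fst (C k) = halt_state M" "read_num (snd (C k) ! 0) = f n"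
    using M(3) unfolding computes_def C_def by (metis fst_conv snd_conv)
  then obtain j where j: "fst (C j) = halt_state M" and
    sim: "exec \<phi> (While (\<lambda>r. r 9 \<noteq> halt_state M) (Act (sim_step M) ;; inc 10))
       (with_config \<sigma> (C 0)) (with_config (\<sigma>(10 := num_tape (n + j))) (C j))"
    using exec_simulation[OF M(1,2), where \<sigma> = \<sigma> and n = n and \<psi> = "\<lambda>_. 0" and k = k and \<phi> = \<phi>]
    unfolding C_def by (auto simp: \<sigma>_def)
  \<comment> \<open>Halting configurations are fixed by \<open>step\<close>, so the first halting
    time shows the same output as the time \<open>k\<close> provided by
    \<open>computes\<close>.\<close>
  have fixed: "C (j + i) = C j" for i
    by (induction i) (use j in \<open>simp_all add: C_def step_def case_prod_beta\<close>)
  have "C k = C j"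
  proof (cases "j \<le> k")
    case True
    then show ?thesis using fixed[of "k - j"] by simp
  next
    case False
    have "C (k + i) = C k" for i
      by (induction i) (use k in \<open>simp_all add: C_def step_def case_prod_beta\<close>)
    from this[of "j - k"] False show ?thesis by simp
  qed
  define t where "t = snd (C j) ! 0"
  have out: "read_num t = f n" using k(2) \<open>C k = C j\<close> by (simp add: t_def)
  have valid: "valid M (n + j) (C j)" unfolding C_def by (rule valid_steps[OF M(1,2)])
  then have len: "length (snd (C j)) = n_tapes M"
    and supp: "\<And>i m. i < n_tapes M \<Longrightarrow> int (n + j) < \<bar>m\<bar> \<Longrightarrow> (snd (C j) ! i) m = 0"
    by (auto simp: valid_def)
  let ?v = "f n"
  let ?\<sigma>1 = "with_config (\<sigma>(10 := num_tape (n + j))) (C j)"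
  let ?\<sigma>2 = "?\<sigma>1(12 := \<lambda>i. t (i + int ?v), y := num_tape (R y + ?v), 10 := num_tape (n + j + ?v))"
  let ?\<sigma>3 = "?\<sigma>2(9 := blank_tape)"
  have 1: "exec \<phi> (move2 x 12 10) (num_tape \<circ> R) (num_tape \<circ> R(x := 0, 12 := n, 10 := n))"
    using run_move2[of x 12 10 _ R \<phi>] xy R by (simp add: run_def n_def)
  have 2: "exec \<phi> (Act (set_state (start_state M))) (num_tape \<circ> R(x := 0, 12 := n, 10 := n))
      (with_config \<sigma> (C 0))"
    using xy R N by (intro exec_ActI)
      (auto simp: C_def init_config_eq set_state_def with_config_def idle_def heads_def \<sigma>_def num_tape_0)
  have 3: "exec \<phi> (copy_output y) ?\<sigma>1 ?\<sigma>2"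
  proof -
    have "exec \<phi> (copy_output y) ?\<sigma>1 (?\<sigma>1(12 := \<lambda>i. t (i + int (read_num t)),
        y := num_tape (R y + read_num t), 10 := num_tape (n + j + read_num t)))"
    proof (rule exec_copy_output)
      show "t (int (n + j + 1)) \<noteq> 1" using supp[of 0 "int (n + j + 1)"] N by (simp add: t_def)
    qed (use xy len N in \<open>auto simp: with_config_def \<sigma>_def t_def\<close>)
    then show ?thesis by (simp add: out)
  qed
  have 4: "exec \<phi> (Act (set_state 0)) ?\<sigma>2 ?\<sigma>3"
    using xy by (intro exec_ActI)
      (auto simp: set_state_def idle_def heads_def with_config_def blank_tape_def fun_eq_iff)
  have 5: "exec \<phi> (erase_block (n_tapes M)) ?\<sigma>3
      (\<lambda>i. if i = 10 \<or> 12 \<le> i \<and> i < 12 + n_tapes M then blank_tape else ?\<sigma>3 i)"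
  proof (rule exec_erase_block)
    show "?\<sigma>3 10 = num_tape (n + j + ?v)" by simp
    show "?\<sigma>3 11 = blank_tape"
      using xy R by (simp add: with_config_def \<sigma>_def num_tape_0)
    fix i m assume i: "12 \<le> i" "i < 12 + n_tapes M" "int (n + j + ?v) < \<bar>m\<bar>"
    show "?\<sigma>3 i m = 0"
    proof (cases "i = 12")
      case True
      \<comment> \<open>Tape 12 has been shifted by the length of the output, hence the additional
        summand in the bound.\<close>
      then show ?thesis using xy i supp[of 0 "m + int ?v"] N by (simp add: t_def)
    next
      case False
      then show ?thesis using xy i supp[of "i - 12" m] len by (simp add: with_config_def)
    qed
  qed
  have "(\<lambda>i. if i = 10 \<or> 12 \<le> i \<and> i < 12 + n_tapes M then blank_tape else ?\<sigma>3 i) = num_tape \<circ> R'"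
    using xy R len N by (auto simp: R' with_config_def \<sigma>_def num_tape_0 n_def fun_eq_iff)
  note 5 = 5[unfolded this]
  show ?thesis unfolding run_def call_def
    by (rule exec_Seq[OF 1 exec_Seq[OF 2 exec_Seq[OF sim exec_Seq[OF 3 exec_Seq[OF 4 5]]]]])
qed

lemma wf_call:
  assumes "oracle_machine M" "x < 9" "y < 9" "12 + n_tapes M \<le> N"
    and "n_states M \<le> S" "n_symbols M \<le> S"
  shows "wf_com N S (call M x y)"
proof -
  have M: "2 \<le> n_tapes M" "2 \<le> S" "start_state M < S"
    using assms by (auto simp: oracle_machine_def)
  have "local_act N (sim_step M)"
    unfolding local_act_def
  proof (intro allI impI)
    fix r r' :: heads and i assume r: "\<forall>i<N. r i = r' i" "i < N"
    then have "map (\<lambda>i. r (12 + i)) [0..<n_tapes M] = map (\<lambda>i. r' (12 + i)) [0..<n_tapes M]"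
      "r 9 = r' 9" using assms(4) by auto
    with r show "sim_step M r i = sim_step M r' i"
      by (simp add: sim_step_def Let_def idle_def del: map_eq_conv)
  qed
  moreover have "bounded_act N S (sim_step M)"
    unfolding bounded_act_def
  proof (intro allI impI)
    fix r :: heads and i assume r: "\<forall>i<N. r i < S" "i < N"
    let ?ss = "map (\<lambda>i. r (12 + i)) [0..<n_tapes M]"
    obtain q' as where d: "delta M (r 9) ?ss = (q', as)" by force
    show "fst (sim_step M r i) < S"
    proof (cases "r 9 < n_states M \<and> (\<forall>s\<in>set ?ss. s < n_symbols M)")
      case True
      have len: "length ?ss = n_tapes M" by simp
      have "q' < n_states M" "length as = n_tapes M" "\<forall>a\<in>set as. fst a < n_symbols M"
        using oracle_machine_delta[OF assms(1) _ len _ d] True by auto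
      then have "q' < S" "\<And>i. i < n_tapes M \<Longrightarrow> fst (as ! i) < S"
        using assms(5,6) by (auto intro: less_le_trans)
      moreover have "sim_step M r i = (if i = 9 then (q', Stay)
          else if 12 \<le> i \<and> i < 12 + n_tapes M then as ! (i - 12) else (r i, Stay))"
        unfolding sim_step_def Let_def d using True by simp
      ultimately show ?thesis using r by auto
    next
      \<comment> \<open>Boundedness concerns all symbols below \<open>S\<close>, including those
        outside the table of \<open>M\<close>; there \<open>sim_step\<close> changes
        nothing.\<close>
      case False
      then have "sim_step M r = idle r" unfolding sim_step_def Let_def by auto
      then show ?thesis using r by (simp add: idle_def)
    qed
  qed
  ultimately show ?thesis
    using M assms(2-4)
    by (auto simp: call_def copy_output_def erase_block_def set_state_def block_left_def
        block_erase_def wf_macros wf_dec wf_inc local_test_def nonzero_def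
        local_act_def bounded_act_def idle_def)
qed

lemma num_queries_call [simp]: "num_queries (call M x y) = 0"
  by (simp add: call_def copy_output_def erase_block_def)

section \<open>The search program\<close>

definition regs :: "nat list \<Rightarrow> nat \<Rightarrow> nat" where
  "regs xs = (\<lambda>i. if i < length xs then xs ! i else 0)"

lemma regs_nth [simp]: "i < length xs \<Longrightarrow> regs xs i = xs ! i"
  by (simp add: regs_def)

lemma regs_upd [simp]: "i < length xs \<Longrightarrow> (regs xs)(i := v) = regs (xs[i := v])"
  by (auto simp: regs_def fun_eq_iff)

text \<open>
  A candidate \<open>k = \<langle>i, \<langle>j, \<langle>n, d\<rangle>\<rangle>\<rangle>\<close> is accepted if the \<open>i\<close>-th pair in the enumeration \<open>g\<close> of the
  subset relation of \<open>\<B>\<close> is \<open>\<langle>b, c\<rangle>\<close> and the \<open>j\<close>-th pair in the enumeration \<open>f\<close> of the subset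
  relation of \<open>\<A>\<close> is \<open>\<langle>\<phi> n, b\<rangle>\<close>. The component \<open>d\<close> is ignored; it makes every accepted choice of
  \<open>i\<close>, \<open>j\<close> and \<open>n\<close> recur beyond each bound.
\<close>

definition cand_B :: "nat \<Rightarrow> nat" where
  "cand_B k = fst (prod_decode k)"

definition cand_A :: "nat \<Rightarrow> nat" where
  "cand_A k = fst (prod_decode (snd (prod_decode k)))"

definition cand_query :: "nat \<Rightarrow> nat" where
  "cand_query k = fst (prod_decode (snd (prod_decode (snd (prod_decode k)))))"

definition accepts :: "(nat \<Rightarrow> nat) \<Rightarrow> (nat \<Rightarrow> nat) \<Rightarrow> (nat \<Rightarrow> nat) \<Rightarrow> nat \<Rightarrow> bool" where
  "accepts f g \<phi> k \<longleftrightarrow> f (cand_A k) = prod_encode (\<phi> (cand_query k), fst (prod_decode (g (cand_B k))))"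

text \<open>Register 1 is the oracle tape, so \<open>n\<close> is decoded directly onto it and the
  answer appears there. Register 0 is advanced already, ready for the next candidate.\<close>

definition attempt :: "otm \<Rightarrow> otm \<Rightarrow> com" where
  "attempt A B =
     clear 1 ;; clear 2 ;; clear 3 ;; clear 7 ;; clear 8 ;;
     move2 0 2 3 ;; move 3 0 ;; inc 0 ;;
     decode 2 4 5 ;; decode 5 6 7 ;; decode 7 1 8 ;; clear 8 ;;
     Query ;;
     call A 6 2 ;; decode 2 3 7 ;;
     call B 4 2 ;; decode 2 5 8 ;; clear 8 ;; move2 5 2 8 ;;
     cancel 3 1 ;; cancel 7 8"

text \<open>The initial stroke on register 3 makes the first test succeed, so that at least one
  candidate is tried.\<close>

definition search :: "otm \<Rightarrow> otm \<Rightarrow> com" where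
  "search A B = inc 3 ;;
     While (\<lambda>r. r 1 \<noteq> 0 \<or> r 3 \<noteq> 0 \<or> r 7 \<noteq> 0 \<or> r 8 \<noteq> 0) (attempt A B) ;;
     clear 0 ;; move 2 0"

definition attempted :: "(nat \<Rightarrow> nat) \<Rightarrow> (nat \<Rightarrow> nat) \<Rightarrow> (nat \<Rightarrow> nat) \<Rightarrow> nat \<Rightarrow> nat list" where
  "attempted f g \<phi> k = (let a = fst (prod_decode (f (cand_A k))); b = snd (prod_decode (f (cand_A k)));
      c = fst (prod_decode (g (cand_B k))); p = \<phi> (cand_query k)
    in [Suc k, p - a, c, a - p, 0, 0, 0, b - c, c - b])"

lemma attempted_accepts:
  "accepts f g \<phi> k \<longleftrightarrow> (\<forall>i\<in>{1,3,7,8}. attempted f g \<phi> k ! i = 0)"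
proof -
  obtain a b where "prod_decode (f (cand_A k)) = (a, b)" by force
  moreover from this have "f (cand_A k) = prod_encode (a, b)" by (metis prod_decode_inverse)
  ultimately show ?thesis by (auto simp: accepts_def attempted_def Let_def)
qed

lemma run_attempt:
  assumes A: "oracle_machine A" "oracle_free A" "computes A (\<lambda>_. 0) f"
    and B: "oracle_machine B" "oracle_free B" "computes B (\<lambda>_. 0) g"
  shows "run \<phi> (attempt A B) (regs [k, x1, x2, x3, 0, 0, 0, x7, x8]) (regs (attempted f g \<phi> k))"
proof -
  let ?n = "cand_query k"
  let ?a = "fst (prod_decode (f (cand_A k)))" and ?b = "snd (prod_decode (f (cand_A k)))"
  let ?cd = "g (cand_B k)"
  let ?c = "fst (prod_decode ?cd)"
  have ge9: "regs xs i = 0" if "length xs = 9" "9 \<le> i" for xs i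
    using that by (simp add: regs_def)
  have 1: "run \<phi> (clear 1) (regs [k, x1, x2, x3, 0, 0, 0, x7, x8]) (regs [k, 0, x2, x3, 0, 0, 0, x7, x8])"
    by (rule run_clear) simp
  have 2: "run \<phi> (clear 2) (regs [k, 0, x2, x3, 0, 0, 0, x7, x8]) (regs [k, 0, 0, x3, 0, 0, 0, x7, x8])"
    by (rule run_clear) simp
  have 3: "run \<phi> (clear 3) (regs [k, 0, 0, x3, 0, 0, 0, x7, x8]) (regs [k, 0, 0, 0, 0, 0, 0, x7, x8])"
    by (rule run_clear) simp
  have 4: "run \<phi> (clear 7) (regs [k, 0, 0, 0, 0, 0, 0, x7, x8]) (regs [k, 0, 0, 0, 0, 0, 0, 0, x8])"
    by (rule run_clear) simp
  have 5: "run \<phi> (clear 8) (regs [k, 0, 0, 0, 0, 0, 0, 0, x8]) (regs [k, 0, 0, 0, 0, 0, 0, 0, 0])"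
    by (rule run_clear) simp
  have 6: "run \<phi> (move2 0 2 3) (regs [k, 0, 0, 0, 0, 0, 0, 0, 0]) (regs [0, 0, k, k, 0, 0, 0, 0, 0])"
    by (rule run_move2) simp_all
  have 7: "run \<phi> (move 3 0) (regs [0, 0, k, k, 0, 0, 0, 0, 0]) (regs [k, 0, k, 0, 0, 0, 0, 0, 0])"
    by (rule run_move) simp_all
  have 8: "run \<phi> (inc 0) (regs [k, 0, k, 0, 0, 0, 0, 0, 0]) (regs [Suc k, 0, k, 0, 0, 0, 0, 0, 0])"
    by (rule run_inc) simp
  have 9: "run \<phi> (decode 2 4 5) (regs [Suc k, 0, k, 0, 0, 0, 0, 0, 0])
      (regs [Suc k, 0, 0, 0, cand_B k, snd (prod_decode k), 0, 0, 0])"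
    by (rule run_decode) (simp_all add: cand_B_def)
  have 10: "run \<phi> (decode 5 6 7) (regs [Suc k, 0, 0, 0, cand_B k, snd (prod_decode k), 0, 0, 0])
      (regs [Suc k, 0, 0, 0, cand_B k, 0, cand_A k, snd (prod_decode (snd (prod_decode k))), 0])"
    by (rule run_decode) (simp_all add: cand_A_def)
  \<comment> \<open>\<open>d\<close> is the padding component of the candidate; it is wiped at
    once.\<close>
  obtain d where 11: "run \<phi> (decode 7 1 8)
      (regs [Suc k, 0, 0, 0, cand_B k, 0, cand_A k, snd (prod_decode (snd (prod_decode k))), 0])
      (regs [Suc k, ?n, 0, 0, cand_B k, 0, cand_A k, 0, d])"
    by (rule that, rule run_decode) (simp_all add: cand_query_def)
  have 12: "run \<phi> (clear 8) (regs [Suc k, ?n, 0, 0, cand_B k, 0, cand_A k, 0, d])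
      (regs [Suc k, ?n, 0, 0, cand_B k, 0, cand_A k, 0, 0])"
    by (rule run_clear) simp
  have 13: "run \<phi> Query (regs [Suc k, ?n, 0, 0, cand_B k, 0, cand_A k, 0, 0])
      (regs [Suc k, \<phi> ?n, 0, 0, cand_B k, 0, cand_A k, 0, 0])"
    by (rule run_Query) simp
  have 14: "run \<phi> (call A 6 2) (regs [Suc k, \<phi> ?n, 0, 0, cand_B k, 0, cand_A k, 0, 0])
      (regs [Suc k, \<phi> ?n, f (cand_A k), 0, cand_B k, 0, 0, 0, 0])"
    by (rule run_call[OF A]) (simp_all add: ge9)
  have 15: "run \<phi> (decode 2 3 7) (regs [Suc k, \<phi> ?n, f (cand_A k), 0, cand_B k, 0, 0, 0, 0])
      (regs [Suc k, \<phi> ?n, 0, ?a, cand_B k, 0, 0, ?b, 0])"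
    by (rule run_decode) simp_all
  have 16: "run \<phi> (call B 4 2) (regs [Suc k, \<phi> ?n, 0, ?a, cand_B k, 0, 0, ?b, 0])
      (regs [Suc k, \<phi> ?n, ?cd, ?a, 0, 0, 0, ?b, 0])"
    by (rule run_call[OF B]) (simp_all add: ge9)
  have 17: "run \<phi> (decode 2 5 8) (regs [Suc k, \<phi> ?n, ?cd, ?a, 0, 0, 0, ?b, 0])
      (regs [Suc k, \<phi> ?n, 0, ?a, 0, ?c, 0, ?b, snd (prod_decode ?cd)])"
    by (rule run_decode) simp_all
  have 18: "run \<phi> (clear 8) (regs [Suc k, \<phi> ?n, 0, ?a, 0, ?c, 0, ?b, snd (prod_decode ?cd)])
      (regs [Suc k, \<phi> ?n, 0, ?a, 0, ?c, 0, ?b, 0])"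
    by (rule run_clear) simp
  have 19: "run \<phi> (move2 5 2 8) (regs [Suc k, \<phi> ?n, 0, ?a, 0, ?c, 0, ?b, 0])
      (regs [Suc k, \<phi> ?n, ?c, ?a, 0, 0, 0, ?b, ?c])"
    by (rule run_move2) simp_all
  have 20: "run \<phi> (cancel 3 1) (regs [Suc k, \<phi> ?n, ?c, ?a, 0, 0, 0, ?b, ?c])
      (regs [Suc k, \<phi> ?n - ?a, ?c, ?a - \<phi> ?n, 0, 0, 0, ?b, ?c])"
    by (rule run_cancel) simp_all
  have 21: "run \<phi> (cancel 7 8) (regs [Suc k, \<phi> ?n - ?a, ?c, ?a - \<phi> ?n, 0, 0, 0, ?b, ?c])
      (regs (attempted f g \<phi> k))"
    by (rule run_cancel) (simp_all add: attempted_def Let_def)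
  show ?thesis
    unfolding attempt_def by (rule run_Seq, rule 1 2 3 4 5 6 7 8 9 10 11 12 13 14 15 16 17 18 19 20)+ (rule 21)
qed

lemma run_search:
  assumes A: "oracle_machine A" "oracle_free A" "computes A (\<lambda>_. 0) f"
    and B: "oracle_machine B" "oracle_free B" "computes B (\<lambda>_. 0) g"
    and ex: "\<exists>k\<ge>m. accepts f g \<phi> k"
  shows "\<exists>R. run \<phi> (search A B) ((\<lambda>_. 0)(0 := m)) R \<and>
    R 0 = fst (prod_decode (g (cand_B (LEAST k. m \<le> k \<and> accepts f g \<phi> k))))"
proof -
  let ?k = "LEAST k. m \<le> k \<and> accepts f g \<phi> k"
  let ?c = "fst (prod_decode (g (cand_B ?k)))"
  let ?b = "\<lambda>r :: heads. r 1 \<noteq> 0 \<or> r 3 \<noteq> 0 \<or> r 7 \<noteq> 0 \<or> r 8 \<noteq> 0"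
  have k: "m \<le> ?k" "accepts f g \<phi> ?k" using LeastI_ex[OF ex[unfolded Bex_def]] by auto
  have less: "\<not> accepts f g \<phi> (m + j)" if "m + j < ?k" for j
    using not_less_Least[OF that] by simp
  \<comment> \<open>\<open>st j\<close> lists the registers after \<open>j\<close> attempts; the
    last candidate tried is then \<open>m + j - 1\<close>.\<close>
  define st where "st j = (case j of 0 \<Rightarrow> [m, 0, 0, 1, 0, 0, 0, 0, 0] | Suc i \<Rightarrow> attempted f g \<phi> (m + i))" for j
  have st: "\<exists>x1 x2 x3 x7 x8. st j = [m + j, x1, x2, x3, 0, 0, 0, x7, x8]" for j
    by (cases j) (simp_all add: st_def attempted_def Let_def)
  have test: "?b (heads (num_tape \<circ> regs (st j))) \<longleftrightarrow> \<not> (\<forall>i\<in>{1,3,7,8}. st j ! i = 0)" for j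
    using st[of j] by auto
  have start: "regs [m, 0, 0, 0, 0, 0, 0, 0, 0] = (\<lambda>_. 0)(0 := m)"
    by (auto simp: regs_def fun_eq_iff nth_Cons split: nat.splits)
  have 1: "run \<phi> (inc 3) (regs [m, 0, 0, 0, 0, 0, 0, 0, 0]) (regs (st 0))"
    by (rule run_inc) (simp add: st_def)
  have 2: "run \<phi> (While ?b (attempt A B)) (regs (st 0)) (regs (attempted f g \<phi> ?k))"
  \<comment> \<open>The candidates from \<open>m\<close> to \<open>?k\<close> inclusive are tried,
    hence the \<open>Suc\<close>.\<close>
  proof (rule run_While[where n = "Suc (?k - m)" and \<rho> = "\<lambda>j. regs (st j)"])
    fix j assume j: "j < Suc (?k - m)"
    show "?b (heads (num_tape \<circ> regs (st j)))"
    proof (cases j)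
      case 0
      then show ?thesis unfolding test by (simp add: st_def)
    next
      case (Suc i)
      then have "\<not> accepts f g \<phi> (m + i)" using j k less by simp
      then show ?thesis unfolding test attempted_accepts by (simp add: st_def Suc)
    qed
    have "st (Suc j) = attempted f g \<phi> (m + j)" by (simp add: st_def)
    then show "run \<phi> (attempt A B) (regs (st j)) (regs (st (Suc j)))"
      using run_attempt[OF A B] st[of j] by metis
  next
    show "\<not> ?b (heads (num_tape \<circ> regs (st (Suc (?k - m)))))"
      unfolding test using k attempted_accepts[of f g \<phi> ?k] by (simp add: st_def)
    show "regs (st (Suc (?k - m))) = regs (attempted f g \<phi> ?k)" using k by (simp add: st_def)
  qed simp
  have 3: "run \<phi> (clear 0) (regs (attempted f g \<phi> ?k)) (regs ((attempted f g \<phi> ?k)[0 := 0]))"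
    by (rule run_clear) (simp add: attempted_def Let_def)
  have 4: "run \<phi> (move 2 0) (regs ((attempted f g \<phi> ?k)[0 := 0]))
      (regs ((attempted f g \<phi> ?k)[0 := ?c, 2 := 0]))"
    by (rule run_move) (simp_all add: attempted_def Let_def)
  have "run \<phi> (search A B) ((\<lambda>_. 0)(0 := m)) (regs ((attempted f g \<phi> ?k)[0 := ?c, 2 := 0]))"
    unfolding search_def start[symmetric]
    by (rule run_Seq[OF 1 run_Seq[OF 2 run_Seq[OF 3 4]]])
  moreover have "regs ((attempted f g \<phi> ?k)[0 := ?c, 2 := 0]) 0 = ?c"
    by (simp add: attempted_def Let_def)
  ultimately show ?thesis by blast
qed

lemma search_machine:
  assumes A: "oracle_machine A" "oracle_free A" "computes A (\<lambda>_. 0) f"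
    and B: "oracle_machine B" "oracle_free B" "computes B (\<lambda>_. 0) g"
  shows "\<exists>M. oracle_machine M \<and> (\<forall>\<phi>. (\<forall>m. \<exists>k\<ge>m. accepts f g \<phi> k) \<longrightarrow> computes M \<phi>
      (\<lambda>m. fst (prod_decode (g (cand_B (LEAST k. m \<le> k \<and> accepts f g \<phi> k))))))"
proof -
  \<comment> \<open>Both subroutines work on the block starting at tape 12. \<open>S\<close> has to
    exceed states as well as symbols, since states are written on tape 9.\<close>
  define N where "N = 12 + n_tapes A + n_tapes B"
  define S where "S = n_states A + n_symbols A + n_states B + n_symbols B"
  have S: "2 \<le> S" using A(1) by (simp add: S_def oracle_machine_def)
  have N: "12 \<le> N" by (simp add: N_def)
  have "wf_com N S (call A 6 2)" "wf_com N S (call B 4 2)"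
    by (rule wf_call; use A(1) B(1) in \<open>simp add: N_def S_def\<close>)+
  then have "wf_com N S (search A B)"
    using S N by (simp add: search_def attempt_def wf_macros wf_inc local_test_def)
  moreover have "num_queries (search A B) = 1"
    by (simp add: search_def attempt_def)
  ultimately obtain M where M: "oracle_machine M"
    "\<And>\<phi> \<psi>. (\<And>n. \<exists>\<sigma>. exec \<phi> (search A B) (num_tape \<circ> (\<lambda>_. 0)(0 := n)) \<sigma> \<and> \<sigma> 0 = num_tape (\<psi> n)) \<Longrightarrow>
      computes M \<phi> \<psi>"
    using machine_of_program[of N S "search A B"] S N by auto
  show ?thesis
  proof (intro exI[of _ M] conjI M allI impI)
    fix \<phi> n assume "\<forall>m. \<exists>k\<ge>m. accepts f g \<phi> k"
    from run_search[OF A B this[rule_format, of n]] obtain R where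
      "run \<phi> (search A B) ((\<lambda>_. 0)(0 := n)) R"
      "R 0 = fst (prod_decode (g (cand_B (LEAST k. n \<le> k \<and> accepts f g \<phi> k))))" by blast
    then show "\<exists>\<sigma>. exec \<phi> (search A B) (num_tape \<circ> (\<lambda>_. 0)(0 := n)) \<sigma> \<and>
        \<sigma> 0 = num_tape (fst (prod_decode (g (cand_B (LEAST k. n \<le> k \<and> accepts f g \<phi> k)))))"
      unfolding run_def by (intro exI[of _ "num_tape \<circ> R"]) simp
  qed
qed

section \<open>Translating oracles\<close>

lemma basis_subset:
  assumes "basis_for \<B> X" "openin X U" "x \<in> U"
  obtains B where "B \<in> \<B>" "x \<in> B" "B \<subseteq> U"
proof -
  have "(arbitrary union_of (\<lambda>U. U \<in> \<B>)) U"
    using assms(1,2) by (simp add: basis_for_def)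
  then show ?thesis using assms(3) that unfolding union_of_def by blast
qed

lemma basis_open: "basis_for \<B> X \<Longrightarrow> B \<in> \<B> \<Longrightarrow> openin X B"
  unfolding basis_for_def by (metis arbitrary_union_of_inc)

lemma oracle_for_iff:
  "oracle_for \<B> \<nu> x \<phi> \<longleftrightarrow> (\<forall>n. \<nu> (\<phi> n) \<in> \<B>) \<and> (\<forall>n. x \<in> \<nu> (\<phi> n)) \<and>
    (\<forall>B\<in>\<B>. x \<in> B \<longrightarrow> (\<exists>n. \<nu> (\<phi> n) \<subseteq> B))"
proof -
  have "{\<nu> (\<phi> n) |n. True} = range (\<lambda>n. \<nu> (\<phi> n))" by auto
  then show ?thesis
    by (simp add: oracle_for_def code_dom_def local_basis_def image_subset_iff)
qed

text \<open>Uniformity is the order of quantifiers: \<open>M\<close> precedes \<open>x\<close> and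
  \<phi>, while \<psi> may depend on both.\<close>

theorem theorem9:
  fixes \<A> \<B> :: "'a set set" and \<nu> :: "nat \<Rightarrow> 'a set"
  assumes "effective_topology \<A> \<nu>" and "effective_topology \<B> \<nu>"
    and "re_subset_relation \<A> \<nu>" and "re_subset_relation \<B> \<nu>"
    and "\<B> \<subseteq> \<A>"
    and "\<exists>X. basis_for \<A> X \<and> basis_for \<B> X"
  shows "\<exists>M. oracle_machine M \<and>
    (\<forall>x \<phi>. oracle_for \<A> \<nu> x \<phi> \<longrightarrow>
      (\<exists>\<psi>. computes M \<phi> \<psi> \<and> oracle_for \<B> \<nu> x \<psi>))"
proof -
  define rel where "rel \<C> = {prod_encode (b1, b2) | b1 b2.
       b1 \<in> code_dom \<C> \<nu> \<and> b2 \<in> code_dom \<C> \<nu> \<and> \<nu> b1 \<subseteq> \<nu> b2}" for \<C>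
  have rel: "prod_encode (a, b) \<in> rel \<C> \<longleftrightarrow> \<nu> a \<in> \<C> \<and> \<nu> b \<in> \<C> \<and> \<nu> a \<subseteq> \<nu> b" for a b \<C>
    by (auto simp: rel_def code_dom_def)
  obtain X where X: "basis_for \<A> X" "basis_for \<B> X" using assms(6) by blast
  have code: "\<exists>b. \<nu> b = B" if "B \<in> \<B>" for B
    using that assms(2) unfolding effective_topology_def coding_def by blast
  \<comment> \<open>Equality of the topologies enters here: a member of \<A> is open, so the basis
    \<B> refines it at \<open>x\<close>.\<close>
  have small: "\<exists>B\<in>\<B>. x \<in> B \<and> B \<subseteq> A" if "A \<in> \<A>" "x \<in> A" for A x
    by (rule basis_subset[OF X(2) basis_open[OF X(1) that(1)] that(2)]) blast
  have member: "\<exists>b. \<nu> b \<in> \<B>" if "oracle_for \<A> \<nu> x \<phi>" for x \<phi>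
  proof -
    have "\<nu> (\<phi> 0) \<in> \<A>" "x \<in> \<nu> (\<phi> 0)"
      using that by (simp_all add: oracle_for_iff)
    from small[OF this] obtain B where "B \<in> \<B>" by blast
    with code[OF this] show ?thesis by blast
  qed
  show ?thesis
  \<comment> \<open>An empty recursively enumerable set comes with no enumerating function to run,
    so this case is split off.\<close>
  proof (cases "\<exists>b. \<nu> b \<in> \<B>")
    case False
    have "oracle_machine \<lparr> n_states = 2, n_symbols = 2, n_tapes = 2, start_state = 0, halt_state = 0,
        query_state = 1, answer_state = 0, delta = (\<lambda>_ _. (0, [(0, Stay), (0, Stay)])) \<rparr>"
      by (simp add: oracle_machine_def)
    then show ?thesis using False member by blast
  next
    case True
    then obtain b0 where "\<nu> b0 \<in> \<B>" by blast
    then have "prod_encode (b0, b0) \<in> rel \<A>" "prod_encode (b0, b0) \<in> rel \<B>"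
      using assms(5) by (auto simp: rel)
    then have "rel \<A> \<noteq> {}" "rel \<B> \<noteq> {}" by auto
    moreover have "rec_enumerable (rel \<A>)" "rec_enumerable (rel \<B>)"
      using assms(3,4) by (simp_all only: re_subset_relation_def rel_def)
    ultimately obtain f g where f: "recursive_fun f" "rel \<A> = range f"
      and g: "recursive_fun g" "rel \<B> = range g"
      unfolding rec_enumerable_def by blast
    obtain MA where MA: "oracle_machine MA" "oracle_free MA" "computes MA (\<lambda>_. 0) f"
      using f(1) by (auto simp: recursive_fun_def)
    obtain MB where MB: "oracle_machine MB" "oracle_free MB" "computes MB (\<lambda>_. 0) g"
      using g(1) by (auto simp: recursive_fun_def)
    obtain M where M: "oracle_machine M"
      "\<forall>\<phi>. (\<forall>m. \<exists>k\<ge>m. accepts f g \<phi> k) \<longrightarrow> computes M \<phi>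
        (\<lambda>m. fst (prod_decode (g (cand_B (LEAST k. m \<le> k \<and> accepts f g \<phi> k)))))"
      using search_machine[OF MA MB] by blast
    have "\<exists>\<psi>. computes M \<phi> \<psi> \<and> oracle_for \<B> \<nu> x \<psi>" if \<phi>: "oracle_for \<A> \<nu> x \<phi>" for x \<phi>
    proof -
      have \<phi>A: "\<nu> (\<phi> n) \<in> \<A>" "x \<in> \<nu> (\<phi> n)" for n
        using \<phi> by (simp_all add: oracle_for_iff)
      have \<phi>L: "\<exists>n. \<nu> (\<phi> n) \<subseteq> A" if "A \<in> \<A>" "x \<in> A" for A
        using \<phi> that unfolding oracle_for_iff by simp
      let ?out = "\<lambda>k. fst (prod_decode (g (cand_B k)))"
      have sound: "\<nu> (?out k) \<in> \<B>" "x \<in> \<nu> (?out k)" if acc: "accepts f g \<phi> k" for k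
      proof -
        have "prod_encode (?out k, snd (prod_decode (g (cand_B k)))) \<in> rel \<B>"
          using g(2) by simp
        then show "\<nu> (?out k) \<in> \<B>" by (simp only: rel)
        have "prod_encode (\<phi> (cand_query k), ?out k) \<in> rel \<A>"
          unfolding f(2) by (rule range_eqI[of _ f "cand_A k"]) (use acc in \<open>simp add: accepts_def\<close>)
        then have "\<nu> (\<phi> (cand_query k)) \<subseteq> \<nu> (?out k)" by (simp only: rel)
        then show "x \<in> \<nu> (?out k)" using \<phi>A(2) by blast
      qed
      have complete: "\<exists>k\<ge>m. accepts f g \<phi> k \<and> \<nu> (?out k) = B" if B: "B \<in> \<B>" "x \<in> B" for B m
      proof -
        obtain b where b: "\<nu> b = B" using code B(1) by blast
        obtain n where n: "\<nu> (\<phi> n) \<subseteq> B" using \<phi>L B assms(5) by blast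
        \<comment> \<open>Reflexivity of inclusion turns the enumeration of the subset relation into
          one of all codes of members of \<B>.\<close>
        have "prod_encode (b, b) \<in> rel \<B>" "prod_encode (\<phi> n, b) \<in> rel \<A>"
          unfolding rel using b n B(1) \<phi>A(1)[of n] assms(5) by blast+
        then obtain i j where ij: "g i = prod_encode (b, b)" "f j = prod_encode (\<phi> n, b)"
          unfolding f(2) g(2) by (metis imageE)
        \<comment> \<open>Padding with \<open>m\<close> itself suffices, as a Cantor code is at
          least as large as its second component.\<close>
        let ?k = "prod_encode (i, prod_encode (j, prod_encode (n, m)))"
        have "m \<le> ?k"
          by (rule order_trans[OF le_prod_encode_2 order_trans[OF le_prod_encode_2 le_prod_encode_2]])
        moreover have "accepts f g \<phi> ?k \<and> \<nu> (?out ?k) = B"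
          using ij b by (simp add: accepts_def cand_A_def cand_B_def cand_query_def)
        ultimately show ?thesis by blast
      qed
      have ex: "\<exists>k\<ge>m. accepts f g \<phi> k" for m
      proof -
        obtain B where "B \<in> \<B>" "x \<in> B" using small[OF \<phi>A[of 0]] by blast
        from complete[OF this] show ?thesis by blast
      qed
      define \<psi> where "\<psi> m = ?out (LEAST k. m \<le> k \<and> accepts f g \<phi> k)" for m
      have "computes M \<phi> \<psi>" unfolding \<psi>_def by (rule M(2)[rule_format]) (rule ex)
      moreover have "\<nu> (\<psi> m) \<in> \<B>" "x \<in> \<nu> (\<psi> m)" for m
      proof -
        have "accepts f g \<phi> (LEAST k. m \<le> k \<and> accepts f g \<phi> k)"
          using LeastI_ex[OF ex[of m]] by simp
        then show "\<nu> (\<psi> m) \<in> \<B>" "x \<in> \<nu> (\<psi> m)" unfolding \<psi>_def by (rule sound)+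
      qed
      moreover have "\<exists>m. \<nu> (\<psi> m) \<subseteq> B" if B: "B \<in> \<B>" "x \<in> B" for B
      proof -
        obtain k where k: "accepts f g \<phi> k" "\<nu> (?out k) = B" using complete[OF B] by blast
        \<comment> \<open>Started at an accepted candidate, the search stops immediately; thus
          \<psi> reaches \<open>B\<close> itself and not merely a subset of it.\<close>
        have "(LEAST l. k \<le> l \<and> accepts f g \<phi> l) = k" by (rule Least_equality) (use k in auto)
        then have "\<nu> (\<psi> k) = B" unfolding \<psi>_def using k(2) by simp
        then show ?thesis by blast
      qed
      ultimately have "oracle_for \<B> \<nu> x \<psi>"
        unfolding oracle_for_iff by simp
      with \<open>computes M \<phi> \<psi>\<close> show ?thesis by blast
    qed
    then show ?thesis using M(1) by blast
  qed
qed

end
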